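(* Let $P$ be a function-free program, $G_0$ a p-goal and $SQ$ a stack-queue scheduling rule. If every infinite p-SLD derivation of $G_0$ in $P$ via $SQ$ is pruned by p-$EVR_L$, then every infinite p-RSLD derivation of $G_0$ in $P$ via $SQ$ is pruned by p-$EVR_L$.
   Context: Function-free means no function symbols of positive arity occur. A p-atom is a pair $a[p]$ of an atom $a$ and a rational priority $p$. A p-goal is a finite set of p-atoms with pairwise distinct priorities, regarded as a list ordered by increasing priority. Substitutions act on atoms and leave priorities unchanged. A clause is $h\leftarrow B$ with $h$ an atom and $B$ a p-goal; a program is a finite set of clauses. For p-goals with no common priority, $F+G=F\cup G$; $F|G$ denotes $F+G$ when all priorities of $F$ are smaller than those of $G$. A shifting $\underline{\pi}$ is a strictly increasing bijection $\mathbb{Q}\to\mathbb{Q}$ acting on priorities. Priority derivation step: for a p-goal $a|F$ ($a$ of least priority), clause $c=(h\leftarrow B)$, renaming $\xi$ with $var(a|F)\cap var(c\xi)=\emptyset$, idempotent relevant mgu $\theta$ of $a$ and $h\xi$, shifting $\underline{\pi}$ with $F$, $B\xi\underline{\pi}$ sharing no priority: $a|F\xrightarrow{c\xi,\theta}(F+B\xi\underline{\pi})\theta$. A p-SLD derivation of $G_0$ in $P$ is a finite or infinite sequence of such steps with clauses in $P$ and each renamed clause variable-disjoint from $G_0$ and all earlier renamed clauses; it is via $S$ if all steps belong to $S$. Lowering: for $c=(h\leftarrow B)$, a step $a\lambda\underline{\sigma}|(K\lambda\underline{\sigma}+X)\xrightarrow{c}(X+K\lambda\underline{\sigma}+B\xi''\underline{\theta}'')\alpha''$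 is a lowering by $X$ of $a|K\xrightarrow{c}(K+B\xi'\underline{\theta}')\alpha'$; a congruent lowering if some shifting $\underline{\rho}$ has $K\underline{\rho}=K\underline{\sigma}$ and $B\underline{\theta}'\underline{\rho}=B\underline{\theta}''$. Steps are congruent lowerings of each other if each is a congruent lowering of the other. A set $S$ of steps is complete if (i) whenever some step $G\xrightarrow{c}\cdot$ exists, some step $G\xrightarrow{c}\cdot$ lies in $S$, and (ii) $S$ contains every step that is a congruent lowering of each other with a step of $S$. Stack-queue scheduling rule: a complete set $SQ$ of steps such that for every clause $c=(h\leftarrow B)$ there are p-goals $M_s,M_q$ with $B=M_s|M_q$ such that every step $a|K\xrightarrow{c\xi,\mu}R$ in $SQ$ satisfies $R=(M_s\xi\underline{\gamma}|K|M_q\xi\underline{\gamma})\mu$ for some shifting $\underline{\gamma}$. Priority reduced goal: $G>>^{\tau}N$ up to variable set $X$ if (i) $G=F+\{a_1[p_1],\dots,a_h[p_h]\}+A_1+\dots+A_h$ with $b\tau=a_j$ for every $b[s]\in A_j$; (ii) $N=F+\{a_1[r_1],\dots,a_h[r_h]\}$ with $r_j=\min(\{p_j\}\cup\{\text{priorities of }A_j\})$; (iii) $x\tau=x$ for all $x\in X\cup var(N)$. p-RSLD derivation of $G_0$ in $P$: a finite or infinite sequence $G_0>>^{\alpha_0}N_0\xrightarrow{c_0\xi_0,\theta_0}G_1>>^{\alpha_1}N_1\xrightarrow{c_1\xi_1,\theta_1}\cdots$ where each $N_j\xrightarrow{c_j\xi_j,\theta_j}G_{j+1}$ is a priority derivation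 step with $c_j\in P$ and $var(c_j\xi_j)\cap(var(G_0)\cup var(c_0\xi_0)\cup\dots\cup var(c_{j-1}\xi_{j-1}))=\emptyset$, and $G_j>>^{\alpha_j}N_j$ up to $var(G_0\theta_0\cdots\theta_{j-1})$; it is via $S$ if all its derivation steps belong to $S$. A p-SLD derivation is the special case $N_j=G_j$ for all $j$. p-$EVR_L$ check: such a derivation is pruned by p-$EVR_L$ if there exist $0\le i<j$, a renaming $\tau$ and a shifting $\underline{\tau}$ with $G_0\theta_0\cdots\theta_{j-1}=G_0\theta_0\cdots\theta_{i-1}\tau$ and $N_j=N_i\tau\underline{\tau}$. *)

theory Defs
  imports Main "HOL.Rat"
begin

datatype trm = V nat | Fn nat "trm list"

datatype atom = At nat "trm list"

type_synonym subst = "nat \<Rightarrow> trm"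

fun subst_t :: "subst \<Rightarrow> trm \<Rightarrow> trm" where
  "subst_t \<theta> (V x) = \<theta> x"
| "subst_t \<theta> (Fn f ts) = Fn f (map (subst_t \<theta>) ts)"

fun vars_t :: "trm \<Rightarrow> nat set" where
  "vars_t (V x) = {x}"
| "vars_t (Fn f ts) = \<Union> (set (map vars_t ts))"

fun ff_t :: "trm \<Rightarrow> bool" where
  "ff_t (V x) = True"
| "ff_t (Fn f ts) = (ts = [])"

fun subst_a :: "subst \<Rightarrow> atom \<Rightarrow> atom" where
  "subst_a \<theta> (At p ts) = At p (map (subst_t \<theta>) ts)"

fun vars_a :: "atom \<Rightarrow> nat set" where
  "vars_a (At p ts) = \<Union> (set (map vars_t ts))"

fun ff_a :: "atom \<Rightarrow> bool" where
  "ff_a (At p ts) = (\<forall>t\<in>set ts. ff_t t)"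

definition sdom :: "subst \<Rightarrow> nat set" where
  "sdom \<theta> = {x. \<theta> x \<noteq> V x}"

definition is_subst :: "subst \<Rightarrow> bool" where
  "is_subst \<theta> \<longleftrightarrow> finite (sdom \<theta>)"

definition svars :: "subst \<Rightarrow> nat set" where
  "svars \<theta> = sdom \<theta> \<union> \<Union> (vars_t ` \<theta> ` sdom \<theta>)"

definition scomp :: "subst \<Rightarrow> subst \<Rightarrow> subst" where
  "scomp \<theta> \<eta> = (\<lambda>x. subst_t \<eta> (\<theta> x))"

definition renaming :: "subst \<Rightarrow> bool" where
  "renaming \<rho> \<longleftrightarrow> (\<exists>f. bij f \<and> finite {x. f x \<noteq> x} \<and> \<rho> = (\<lambda>x. V (f x)))"

definition unifier :: "subst \<Rightarrow> atom \<Rightarrow> atom \<Rightarrow> bool" where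
  "unifier \<theta> a b \<longleftrightarrow> subst_a \<theta> a = subst_a \<theta> b"

definition mgu :: "subst \<Rightarrow> atom \<Rightarrow> atom \<Rightarrow> bool" where
  "mgu \<theta> a b \<longleftrightarrow> is_subst \<theta> \<and> unifier \<theta> a b \<and>
     (\<forall>\<sigma>. unifier \<sigma> a b \<longrightarrow> (\<exists>\<eta>. \<sigma> = scomp \<theta> \<eta>))"

definition idem_relevant_mgu :: "subst \<Rightarrow> atom \<Rightarrow> atom \<Rightarrow> bool" where
  "idem_relevant_mgu \<theta> a b \<longleftrightarrow> mgu \<theta> a b \<and> scomp \<theta> \<theta> = \<theta> \<and>
     svars \<theta> \<subseteq> vars_a a \<union> vars_a b"

type_synonym patom = "atom \<times> rat"
type_synonym pgoal = "patom set"
type_synonym clause = "atom \<times> pgoal"  \<comment> \<open>(h, B) stands for h \<leftarrow> B\<close>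

definition pgoal :: "pgoal \<Rightarrow> bool" where
  "pgoal G \<longleftrightarrow> finite G \<and> inj_on snd G"

definition prios :: "pgoal \<Rightarrow> rat set" where
  "prios G = snd ` G"

definition prio_disj :: "pgoal \<Rightarrow> pgoal \<Rightarrow> bool" where
  "prio_disj F G \<longleftrightarrow> prios F \<inter> prios G = {}"

text \<open>Side condition of F|G: all priorities of F are smaller than those of G.\<close>
definition prio_lt :: "pgoal \<Rightarrow> pgoal \<Rightarrow> bool" where
  "prio_lt F G \<longleftrightarrow> (\<forall>p\<in>prios F. \<forall>q\<in>prios G. p < q)"

definition substg :: "subst \<Rightarrow> pgoal \<Rightarrow> pgoal" where
  "substg \<theta> G = (\<lambda>(a, p). (subst_a \<theta> a, p)) ` G"

definition vars_g :: "pgoal \<Rightarrow> nat set" where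
  "vars_g G = \<Union> ((\<lambda>(a, p). vars_a a) ` G)"

definition shifting :: "(rat \<Rightarrow> rat) \<Rightarrow> bool" where
  "shifting \<pi> \<longleftrightarrow> strict_mono \<pi> \<and> bij \<pi>"

definition shift :: "(rat \<Rightarrow> rat) \<Rightarrow> pgoal \<Rightarrow> pgoal" where
  "shift \<pi> G = (\<lambda>(a, p). (a, \<pi> p)) ` G"

definition least_in :: "atom \<Rightarrow> rat \<Rightarrow> pgoal \<Rightarrow> bool" where
  "least_in a p G \<longleftrightarrow> (a, p) \<in> G \<and> (\<forall>q\<in>prios G. p \<le> q)"

definition rename_clause :: "subst \<Rightarrow> clause \<Rightarrow> clause" where
  "rename_clause \<xi> c = (subst_a \<xi> (fst c), substg \<xi> (snd c))"

definition vars_c :: "clause \<Rightarrow> nat set" where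
  "vars_c c = vars_a (fst c) \<union> vars_g (snd c)"

definition is_clause :: "clause \<Rightarrow> bool" where
  "is_clause c \<longleftrightarrow> pgoal (snd c)"

definition program :: "clause set \<Rightarrow> bool" where
  "program P \<longleftrightarrow> finite P \<and> (\<forall>c\<in>P. is_clause c)"

definition function_free :: "clause set \<Rightarrow> bool" where
  "function_free P \<longleftrightarrow> (\<forall>c\<in>P. ff_a (fst c) \<and> (\<forall>(b, p)\<in>snd c. ff_a b))"

text \<open>A step  G --(c\<xi>,\<theta>)--> R, recorded with goal, (unrenamed) clause, renaming,
  mgu and resulting goal.\<close>
datatype step = Step (sgoal: pgoal) (scl: clause) (sren: subst) (smgu: subst) (sres: pgoal)

definition step_sh :: "pgoal \<Rightarrow> clause \<Rightarrow> subst \<Rightarrow> subst \<Rightarrow> (rat \<Rightarrow> rat) \<Rightarrow> pgoal \<Rightarrow> bool" where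
  "step_sh G c \<xi> \<theta> \<pi> R \<longleftrightarrow> pgoal G \<and> is_clause c \<and>
     (\<exists>a p. least_in a p G \<and>
       renaming \<xi> \<and> vars_g G \<inter> vars_c (rename_clause \<xi> c) = {} \<and>
       idem_relevant_mgu \<theta> a (subst_a \<xi> (fst c)) \<and>
       shifting \<pi> \<and> prio_disj (G - {(a, p)}) (shift \<pi> (substg \<xi> (snd c))) \<and>
       R = substg \<theta> ((G - {(a, p)}) \<union> shift \<pi> (substg \<xi> (snd c))))"

definition valid_step :: "step \<Rightarrow> bool" where
  "valid_step s \<longleftrightarrow> (\<exists>\<pi>. step_sh (sgoal s) (scl s) (sren s) (smgu s) \<pi> (sres s))"

definition congr_lowering :: "step \<Rightarrow> step \<Rightarrow> bool" where
  "congr_lowering s2 s1 \<longleftrightarrow> scl s2 = scl s1 \<and>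
     (\<exists>a p K X lam \<sigma> \<theta>1 \<theta>2 \<rho>.
        step_sh (sgoal s1) (scl s1) (sren s1) (smgu s1) \<theta>1 (sres s1) \<and>
        step_sh (sgoal s2) (scl s2) (sren s2) (smgu s2) \<theta>2 (sres s2) \<and>
        least_in a p (sgoal s1) \<and> K = sgoal s1 - {(a, p)} \<and>
        is_subst lam \<and> shifting \<sigma> \<and>
        prio_disj (shift \<sigma> (substg lam K)) X \<and>
        least_in (subst_a lam a) (\<sigma> p) (sgoal s2) \<and>
        (subst_a lam a, \<sigma> p) \<notin> shift \<sigma> (substg lam K) \<union> X \<and>
        sgoal s2 = insert (subst_a lam a, \<sigma> p) (shift \<sigma> (substg lam K) \<union> X) \<and>
        sres s2 = substg (smgu s2)
           (X \<union> shift \<sigma> (substg lam K) \<union> shift \<theta>2 (substg (sren s2) (snd (scl s2)))) \<and>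
        shifting \<rho> \<and> shift \<rho> K = shift \<sigma> K \<and>
        shift \<rho> (shift \<theta>1 (snd (scl s1))) = shift \<theta>2 (snd (scl s1)))"

definition mutual_congr_lowering :: "step \<Rightarrow> step \<Rightarrow> bool" where
  "mutual_congr_lowering s s' \<longleftrightarrow> congr_lowering s s' \<and> congr_lowering s' s"

definition complete_steps :: "step set \<Rightarrow> bool" where
  "complete_steps S \<longleftrightarrow> (\<forall>s\<in>S. valid_step s) \<and>
     (\<forall>G c. (\<exists>\<xi> \<theta> R. valid_step (Step G c \<xi> \<theta> R)) \<longrightarrow>
            (\<exists>\<xi> \<theta> R. Step G c \<xi> \<theta> R \<in> S)) \<and>
     (\<forall>s\<in>S. \<forall>s'. mutual_congr_lowering s s' \<longrightarrow> s' \<in> S)"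

definition stack_queue :: "step set \<Rightarrow> bool" where
  "stack_queue SQ \<longleftrightarrow> complete_steps SQ \<and>
     (\<forall>h B. pgoal B \<longrightarrow> (\<exists>Ms Mq. B = Ms \<union> Mq \<and> prio_lt Ms Mq \<and>
        (\<forall>G \<xi> \<mu> R. Step G (h, B) \<xi> \<mu> R \<in> SQ \<longrightarrow>
           (\<exists>a p \<gamma>. least_in a p G \<and> shifting \<gamma> \<and>
              prio_lt (shift \<gamma> (substg \<xi> Ms)) (G - {(a, p)}) \<and>
              prio_lt (G - {(a, p)}) (shift \<gamma> (substg \<xi> Mq)) \<and>
              prio_lt (shift \<gamma> (substg \<xi> Ms)) (shift \<gamma> (substg \<xi> Mq)) \<and>
              R = substg \<mu> (shift \<gamma> (substg \<xi> Ms) \<union> (G - {(a, p)}) \<union> shift \<gamma> (substg \<xi> Mq))))))"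

fun sub_upto :: "(nat \<Rightarrow> subst) \<Rightarrow> nat \<Rightarrow> pgoal \<Rightarrow> pgoal" where
  "sub_upto \<theta> 0 G = G"
| "sub_upto \<theta> (Suc j) G = substg (\<theta> j) (sub_upto \<theta> j G)"

definition inf_psld :: "clause set \<Rightarrow> step set \<Rightarrow> pgoal \<Rightarrow> (nat \<Rightarrow> step) \<Rightarrow> bool" where
  "inf_psld P S G0 s \<longleftrightarrow> sgoal (s 0) = G0 \<and>
     (\<forall>j. valid_step (s j) \<and> s j \<in> S \<and> scl (s j) \<in> P \<and>
          sgoal (s (Suc j)) = sres (s j) \<and>
          vars_c (rename_clause (sren (s j)) (scl (s j))) \<inter>
            (vars_g G0 \<union> (\<Union>i<j. vars_c (rename_clause (sren (s i)) (scl (s i))))) = {})"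

definition reduced :: "pgoal \<Rightarrow> subst \<Rightarrow> pgoal \<Rightarrow> nat set \<Rightarrow> bool" where
  "reduced G \<tau> N X \<longleftrightarrow> is_subst \<tau> \<and>
     (\<exists>F (h::nat) (a::nat \<Rightarrow> atom) (p::nat \<Rightarrow> rat) (A::nat \<Rightarrow> pgoal) (r::nat \<Rightarrow> rat).
        inj_on p {..<h} \<and>
        prio_disj F ((\<lambda>j. (a j, p j)) ` {..<h}) \<and>
        (\<forall>j<h. prio_disj F (A j) \<and> prio_disj {(a j, p j)} (A j)) \<and>
        (\<forall>j<h. \<forall>k<h. j \<noteq> k \<longrightarrow> prio_disj {(a j, p j)} (A k) \<and> prio_disj (A j) (A k)) \<and>
        G = F \<union> (\<lambda>j. (a j, p j)) ` {..<h} \<union> (\<Union>j<h. A j) \<and>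
        (\<forall>j<h. \<forall>(b, q)\<in>A j. subst_a \<tau> b = a j) \<and>
        (\<forall>j<h. r j = Min ({p j} \<union> prios (A j))) \<and>
        N = F \<union> (\<lambda>j. (a j, r j)) ` {..<h} \<and>
        (\<forall>x\<in>X \<union> vars_g N. \<tau> x = V x))"

definition inf_prsld :: "clause set \<Rightarrow> step set \<Rightarrow> pgoal \<Rightarrow> (nat \<Rightarrow> pgoal) \<Rightarrow> (nat \<Rightarrow> pgoal)
     \<Rightarrow> (nat \<Rightarrow> subst) \<Rightarrow> (nat \<Rightarrow> step) \<Rightarrow> bool" where
  "inf_prsld P S G0 G N \<alpha> s \<longleftrightarrow> G 0 = G0 \<and>
     (\<forall>j. valid_step (s j) \<and> s j \<in> S \<and> scl (s j) \<in> P \<and>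
          sgoal (s j) = N j \<and> sres (s j) = G (Suc j) \<and>
          vars_c (rename_clause (sren (s j)) (scl (s j))) \<inter>
            (vars_g G0 \<union> (\<Union>i<j. vars_c (rename_clause (sren (s i)) (scl (s i))))) = {} \<and>
          reduced (G j) (\<alpha> j) (N j) (vars_g (sub_upto (\<lambda>i. smgu (s i)) j G0)))"

text \<open>Pruning by p-EVR_L, for mgus \<theta> and reduced goals N (N j = G j for p-SLD).\<close>
definition pruned_EVR :: "pgoal \<Rightarrow> (nat \<Rightarrow> subst) \<Rightarrow> (nat \<Rightarrow> pgoal) \<Rightarrow> bool" where
  "pruned_EVR G0 \<theta> N \<longleftrightarrow> (\<exists>i j \<tau> \<pi>. i < j \<and> renaming \<tau> \<and> shifting \<pi> \<and>
      sub_upto \<theta> j G0 = substg \<tau> (sub_upto \<theta> i G0) \<and>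
      N j = shift \<pi> (substg \<tau> (N i)))"

end

(* In a stack-queue derivation, goals behave as lists: the first atom is resolved, the stack part
   of the body goes to the front and the queue part to the back.

   If all infinite SLD derivations are pruned, then the goals reachable by SLD derivations have
   bounded length: otherwise Koenig's lemma, applied to shortest paths modulo variants, yields an
   infinite derivation whose goals are pairwise no variants. The goals of a reduced derivation are
   matched, up to instantiation, by at least as long goals of ordinary SLD derivations, in which
   the eliminated atoms are kept and later resolved by the clauses already used for the atoms that
   made them redundant. So reduced goals have bounded length as well. As the program is
   function-free, all compound terms in the derivation are instances of subterms of the initial
   goal, so that up to variants only finitely many pairs of instantiated initial goal and reduced
   goal occur, and one of them recurs. *)
theory Submission
  imports Defs
begin

text \<open>Three obstacles shape the proof. Clause variables must avoid the whole history of a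
  derivation, so derivations cannot be composed goal by goal. Steps on lists are therefore defined
  without variable names, as most general members of a set of candidates that depends only on the
  variant class of the list; a path of such steps is afterwards realised with fresh clauses. Next,
  replaying a clause for an eliminated copy puts queue atoms at the end of the list, and these must
  be accounted for as well. The invariant is that the queue atoms of every used instance are covered
  by the present live atoms, all of which stand before the end. Finally, the initial goal may
  contain function symbols, and unification may nest its terms. The compound terms at any moment are
  images of one fixed finite set under the accumulated substitution. An image has no more elements
  than the set, and a term nests no deeper than it has distinct compound subterms, which bounds the
  depth uniformly.\<close>

lemma subst_t_cong: "(\<And>x. x \<in> vars_t t \<Longrightarrow> \<sigma> x = \<tau> x) \<Longrightarrow> subst_t \<sigma> t = subst_t \<tau> t"
  by (induction t) auto

lemma subst_t_V [simp]: "subst_t V t = t"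
  by (induction t) (auto intro: map_idI)

lemma subst_t_scomp: "subst_t (scomp \<sigma> \<tau>) t = subst_t \<tau> (subst_t \<sigma> t)"
  by (induction t) (auto simp: scomp_def)

lemma vars_subst_t: "vars_t (subst_t \<sigma> t) = (\<Union>x\<in>vars_t t. vars_t (\<sigma> x))"
  by (induction t) auto

lemma finite_vars_t [simp]: "finite (vars_t t)"
  by (induction t) auto

lemma subst_a_cong: "(\<And>x. x \<in> vars_a a \<Longrightarrow> \<sigma> x = \<tau> x) \<Longrightarrow> subst_a \<sigma> a = subst_a \<tau> a"
  by (cases a) (auto intro!: subst_t_cong)

lemma subst_a_V [simp]: "subst_a V a = a"
  by (cases a) (auto intro: map_idI)

lemma subst_a_V' [simp]: "subst_a V = id"
  by auto

lemma subst_a_scomp: "subst_a (scomp \<sigma> \<tau>) a = subst_a \<tau> (subst_a \<sigma> a)"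
  by (cases a) (auto simp: subst_t_scomp)

lemma subst_a_id: "(\<And>x. x \<in> vars_a a \<Longrightarrow> \<sigma> x = V x) \<Longrightarrow> subst_a \<sigma> a = a"
  using subst_a_cong[of a \<sigma> V] by simp

lemma vars_subst_a: "vars_a (subst_a \<sigma> a) = (\<Union>x\<in>vars_a a. vars_t (\<sigma> x))"
  by (cases a) (auto simp: vars_subst_t)

lemma finite_vars_a [simp]: "finite (vars_a a)"
  by (cases a) auto

lemma scomp_assoc: "scomp (scomp \<rho> \<sigma>) \<tau> = scomp \<rho> (scomp \<sigma> \<tau>)"
  by (rule ext) (simp add: scomp_def subst_t_scomp[unfolded scomp_def])

lemma scomp_V [simp]: "scomp V \<sigma> = \<sigma>" "scomp \<sigma> V = \<sigma>"
  by (auto simp: scomp_def)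

subsection \<open>Unification\<close>

definition eqs_unifier :: "subst \<Rightarrow> (trm \<times> trm) list \<Rightarrow> bool" where
  "eqs_unifier \<sigma> es \<longleftrightarrow> (\<forall>(s, t)\<in>set es. subst_t \<sigma> s = subst_t \<sigma> t)"

definition eqs_vars :: "(trm \<times> trm) list \<Rightarrow> nat set" where
  "eqs_vars es = (\<Union>(s, t)\<in>set es. vars_t s \<union> vars_t t)"

text \<open>Absorption of every unifier, \<open>scomp \<theta> \<sigma> = \<sigma>\<close>,
  strengthens the existence of a factor: taking \<sigma> to be \<theta> itself yields idempotence
  together with generality.\<close>

definition eqs_solved :: "subst \<Rightarrow> (trm \<times> trm) list \<Rightarrow> bool" where
  "eqs_solved \<theta> es \<longleftrightarrow> eqs_unifier \<theta> es \<and> finite (sdom \<theta>) \<and> svars \<theta> \<subseteq> eqs_vars es \<and>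
     (\<forall>\<sigma>. eqs_unifier \<sigma> es \<longrightarrow> scomp \<theta> \<sigma> = \<sigma>)"

lemma finite_eqs_vars [simp]: "finite (eqs_vars es)"
  by (auto simp: eqs_vars_def)

lemma size_subst_var: "x \<in> vars_t t \<Longrightarrow> size (\<sigma> x) \<le> size (subst_t \<sigma> t)"
proof (induction t)
  case (Fn f ts)
  then obtain t where t: "t \<in> set ts" "x \<in> vars_t t" by auto
  with Fn have "size (\<sigma> x) \<le> size (subst_t \<sigma> t)" by blast
  also have "\<dots> \<le> size_list size (map (subst_t \<sigma>) ts)"
    using t(1) by (intro size_list_estimation') auto
  finally show ?case by simp
qed simp

text \<open>Occurs check: the instance of a proper subterm is strictly smaller than that of the
  whole term.\<close>

lemma occurs_not_unifiable:
  assumes "x \<in> vars_t t" "t \<noteq> V x"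
  shows "\<sigma> x \<noteq> subst_t \<sigma> t"
proof
  assume eq: "\<sigma> x = subst_t \<sigma> t"
  obtain f ts where t: "t = Fn f ts" using assms by (cases t) auto
  then obtain u where u: "u \<in> set ts" "x \<in> vars_t u" using assms by auto
  have "size (\<sigma> x) \<le> size (subst_t \<sigma> u)" using size_subst_var[OF u(2)] .
  also have "\<dots> \<le> size_list size (map (subst_t \<sigma>) ts)"
    using u(1) by (intro size_list_estimation') auto
  also have "\<dots> < size (subst_t \<sigma> t)" by (simp add: t)
  finally show False using eq by simp
qed

text \<open>Variable elimination. A unifier of the whole list absorbs the binding of
  \<open>x\<close> to \<open>t\<close>, so it also unifies the substituted equations and is absorbed
  there by \<theta>.\<close>

lemma eqs_solved_var:
  assumes x: "x \<notin> vars_t t"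
    and solved: "eqs_solved \<theta> (map (map_prod (subst_t (V(x := t))) (subst_t (V(x := t)))) es)"
  shows "eqs_solved (scomp (V(x := t)) \<theta>) ((V x, t) # es)"
proof -
  let ?d = "V(x := t)"
  let ?es = "map (map_prod (subst_t ?d) (subst_t ?d)) es"
  let ?\<theta> = "scomp ?d \<theta>"
  have dt: "subst_t ?d t = t"
    using x by (subst subst_t_cong[of t _ V]) auto
  have unif: "eqs_unifier \<theta> ?es" and fin: "finite (sdom \<theta>)" and rel: "svars \<theta> \<subseteq> eqs_vars ?es"
    and mg: "\<And>\<sigma>. eqs_unifier \<sigma> ?es \<Longrightarrow> scomp \<theta> \<sigma> = \<sigma>"
    using solved by (auto simp: eqs_solved_def)
  have vd: "vars_t (subst_t ?d u) \<subseteq> vars_t u \<union> vars_t t" for u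
    by (auto simp: vars_subst_t split: if_splits)
  have ev: "eqs_vars ?es \<subseteq> eqs_vars ((V x, t) # es)"
    using vd by (fastforce simp: eqs_vars_def)
  have 1: "eqs_unifier ?\<theta> ((V x, t) # es)"
    using unif dt by (auto simp: eqs_unifier_def subst_t_scomp)
  have sd: "sdom ?\<theta> \<subseteq> insert x (sdom \<theta>)"
    by (auto simp: sdom_def scomp_def)
  have 2: "finite (sdom ?\<theta>)" using finite_subset[OF sd] fin by simp
  have im: "vars_t (\<theta> y) \<subseteq> insert y (svars \<theta>)" for y
    by (cases "y \<in> sdom \<theta>") (auto simp: svars_def sdom_def)
  have 3: "svars ?\<theta> \<subseteq> eqs_vars ((V x, t) # es)"
  proof -
    have A: "sdom ?\<theta> \<subseteq> eqs_vars ((V x, t) # es)"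
    proof -
      have "sdom \<theta> \<subseteq> eqs_vars ((V x, t) # es)" using rel ev by (auto simp: svars_def)
      then show ?thesis using sd by (auto simp: eqs_vars_def)
    qed
    have B: "vars_t (?\<theta> y) \<subseteq> eqs_vars ((V x, t) # es)" if "y \<in> sdom ?\<theta>" for y
    proof -
      have "vars_t (?d y) \<subseteq> eqs_vars ((V x, t) # es)"
        using A that by (auto simp: eqs_vars_def)
      moreover have "vars_t (?\<theta> y) = (\<Union>z\<in>vars_t (?d y). vars_t (\<theta> z))"
        unfolding scomp_def by (rule vars_subst_t)
      ultimately show ?thesis using im rel ev by blast
    qed
    show ?thesis using A B by (auto simp: svars_def)
  qed
  have 4: "scomp ?\<theta> \<sigma> = \<sigma>" if u: "eqs_unifier \<sigma> ((V x, t) # es)" for \<sigma>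
  proof -
    have d: "scomp ?d \<sigma> = \<sigma>"
      using u by (auto simp: scomp_def eqs_unifier_def)
    have "subst_t \<sigma> (subst_t ?d v) = subst_t \<sigma> v" for v
      using subst_t_scomp[of ?d \<sigma> v] d by simp
    then have "eqs_unifier \<sigma> ?es" using u by (fastforce simp: eqs_unifier_def)
    from mg[OF this] d show ?thesis by (simp add: scomp_assoc)
  qed
  show ?thesis using 1 2 3 4 by (auto simp: eqs_solved_def)
qed

text \<open>The summand 1 per equation makes deletion of a trivial equation decrease the measure
  whatever the size of its sides.\<close>

definition eqs_size :: "(trm \<times> trm) list \<Rightarrow> nat" where
  "eqs_size es = (\<Sum>(s, t)\<leftarrow>es. size s + size t + 1)"

lemma eqs_size_zip:
  "length ts = length us \<Longrightarrow> eqs_size (zip ts us) \<le> size_list size ts + size_list size us"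
  by (induction ts us rule: list_induct2) (auto simp: eqs_size_def)

text \<open>Unification by deletion, decomposition and elimination. Elimination lowers the number of
  variables; the other rules lower the size and add no variables. Clashes and occurs check failures
  are excluded by the given unifier.\<close>

lemma eqs_solved_exists:
  "eqs_unifier \<sigma> es \<Longrightarrow> \<exists>\<theta>. eqs_solved \<theta> es"
proof (induction "(card (eqs_vars es), eqs_size es)" arbitrary: es \<sigma>
       rule: wf_induct_rule[OF wf_lex_prod[OF wf_less_than wf_less_than]])
  case 1
  note IH = 1(1) and unif = 1(2)
  have IHc: "\<exists>\<theta>. eqs_solved \<theta> es'"
    if "card (eqs_vars es') < card (eqs_vars es)" "eqs_unifier \<sigma>' es'" for es' \<sigma>'
    using IH[OF _ that(2)] that(1) by simp
  have IHs: "\<exists>\<theta>. eqs_solved \<theta> es'"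
    if "eqs_vars es' \<subseteq> eqs_vars es" "eqs_size es' < eqs_size es" "eqs_unifier \<sigma>' es'" for es' \<sigma>'
  proof -
    have "card (eqs_vars es') \<le> card (eqs_vars es)" using that(1) by (intro card_mono) auto
    then consider "card (eqs_vars es') < card (eqs_vars es)"
      | "card (eqs_vars es') = card (eqs_vars es)" by linarith
    then show ?thesis using IH[OF _ that(3)] that(2) by cases auto
  qed
  have var: "\<exists>\<theta>. eqs_solved \<theta> ((V x, t) # es')"
    if x: "x \<notin> vars_t t" and vs: "eqs_vars ((V x, t) # es') = eqs_vars es"
      and u: "eqs_unifier \<sigma> ((V x, t) # es')" for x t es'
  proof -
    let ?d = "V(x := t)"
    let ?es = "map (map_prod (subst_t ?d) (subst_t ?d)) es'"
    have d: "scomp ?d \<sigma> = \<sigma>"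
      using u by (auto simp: scomp_def eqs_unifier_def)
    have "subst_t \<sigma> (subst_t ?d v) = subst_t \<sigma> v" for v
      using subst_t_scomp[of ?d \<sigma> v] d by simp
    then have u': "eqs_unifier \<sigma> ?es" using u by (fastforce simp: eqs_unifier_def)
    have vd: "vars_t (subst_t ?d u) \<subseteq> (vars_t u \<union> vars_t t) - {x}" for u
      using x by (auto simp: vars_subst_t split: if_splits)
    have "eqs_vars ?es \<subseteq> eqs_vars ((V x, t) # es') - {x}"
      using vd by (fastforce simp: eqs_vars_def)
    moreover have "x \<in> eqs_vars es" using vs by (auto simp: eqs_vars_def)
    ultimately have "eqs_vars ?es \<subset> eqs_vars es" using vs by blast
    then have "card (eqs_vars ?es) < card (eqs_vars es)" by (intro psubset_card_mono) auto
    from IHc[OF this u'] show ?thesis using eqs_solved_var[OF x] by blast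
  qed
  show ?case
  proof (cases es)
    case Nil
    then have "eqs_solved V es"
      by (auto simp: eqs_solved_def eqs_unifier_def sdom_def svars_def)
    then show ?thesis by blast
  next
    case (Cons e es')
    obtain s t where e: "e = (s, t)" by (cases e)
    have ueq: "subst_t \<sigma> s = subst_t \<sigma> t" and u': "eqs_unifier \<sigma> es'"
      using unif Cons e by (auto simp: eqs_unifier_def)
    have drop: "\<exists>\<theta>. eqs_solved \<theta> es" if "s = t"
    proof -
      have "eqs_size es' < eqs_size es"
        by (simp add: Cons e eqs_size_def)
      moreover have sub: "eqs_vars es' \<subseteq> eqs_vars es" by (auto simp: Cons eqs_vars_def)
      ultimately obtain \<theta> where "eqs_solved \<theta> es'" using IHs u' by blast
      then have "eqs_solved \<theta> es"
        using sub that by (auto simp: eqs_solved_def Cons e eqs_unifier_def)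
      then show ?thesis by blast
    qed
    show ?thesis
    proof (cases "\<exists>x. s = V x")
      case True
      then obtain x where s: "s = V x" by blast
      show ?thesis
      proof (cases "x \<in> vars_t t")
        case True
        then have "s = t" using occurs_not_unifiable[OF True] ueq s by auto
        then show ?thesis by (rule drop)
      next
        case False
        then show ?thesis using var[OF False, of es'] Cons e s unif by auto
      qed
    next
      case nv: False
      then obtain f ts where s: "s = Fn f ts" by (cases s) auto
      show ?thesis
      proof (cases t)
        case (V x)
        show ?thesis
        proof (cases "x \<in> vars_t s")
          case True
          then have "s = t" using occurs_not_unifiable[OF True, of \<sigma>] ueq V s by force
          then show ?thesis by (rule drop)
        next
          case False
          have "eqs_vars ((V x, s) # es') = eqs_vars es"
            by (auto simp: Cons e V eqs_vars_def)
          moreover have "eqs_unifier \<sigma> ((V x, s) # es')"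
            using ueq u' V by (auto simp: eqs_unifier_def)
          ultimately obtain \<theta> where "eqs_solved \<theta> ((V x, s) # es')" using var[OF False] by blast
          then have "eqs_solved \<theta> es"
            using \<open>eqs_vars ((V x, s) # es') = eqs_vars es\<close> unfolding eqs_solved_def
            by (auto simp: Cons e V eqs_unifier_def)
          then show ?thesis by blast
        qed
      next
        case (Fn g us)
        have fg: "f = g" and len: "length ts = length us"
          using ueq s Fn by (auto dest: map_eq_imp_length_eq)
        let ?es = "zip ts us @ es'"
        have iff: "eqs_unifier \<sigma>' es \<longleftrightarrow> eqs_unifier \<sigma>' ?es" for \<sigma>'
        proof -
          have "map (subst_t \<sigma>') ts = map (subst_t \<sigma>') us \<longleftrightarrow>
             (\<forall>(a, b)\<in>set (zip ts us). subst_t \<sigma>' a = subst_t \<sigma>' b)"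
            using len by (induction ts us rule: list_induct2) auto
          then show ?thesis by (auto simp: eqs_unifier_def Cons e s Fn fg)
        qed
        have "(\<Union>(a, b)\<in>set (zip ts us). vars_t a \<union> vars_t b) = vars_t s \<union> vars_t t"
          unfolding s Fn using len by (induction ts us rule: list_induct2) auto
        then have vs: "eqs_vars ?es = eqs_vars es"
          by (auto simp: eqs_vars_def Cons e)
        have "eqs_size ?es < eqs_size es"
          using eqs_size_zip[OF len] by (simp add: eqs_size_def Cons e s Fn)
        then obtain \<theta> where "eqs_solved \<theta> ?es" using IHs[of ?es \<sigma>] vs iff unif by auto
        then have "eqs_solved \<theta> es" using vs iff by (simp add: eqs_solved_def)
        then show ?thesis by blast
      qed
    qed
  qed
qed

lemma idem_relevant_mgu_exists:
  assumes "unifier \<sigma> a b"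
  shows "\<exists>\<theta>. idem_relevant_mgu \<theta> a b"
proof -
  obtain p ts q us where ab: "a = At p ts" "b = At q us" by (cases a, cases b)
  have pq: "p = q" and len: "length ts = length us"
    using assms ab by (auto simp: unifier_def dest: map_eq_imp_length_eq)
  have iff: "unifier \<tau> a b \<longleftrightarrow> eqs_unifier \<tau> (zip ts us)" for \<tau>
  proof -
    have "map (subst_t \<tau>) ts = map (subst_t \<tau>) us \<longleftrightarrow>
         (\<forall>(s, t)\<in>set (zip ts us). subst_t \<tau> s = subst_t \<tau> t)"
      using len by (induction ts us rule: list_induct2) auto
    then show ?thesis by (auto simp: unifier_def eqs_unifier_def ab pq)
  qed
  have vs: "eqs_vars (zip ts us) \<subseteq> vars_a a \<union> vars_a b"
    by (auto simp: eqs_vars_def ab dest: set_zip_leftD set_zip_rightD)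
  obtain \<theta> where \<theta>: "eqs_solved \<theta> (zip ts us)" using eqs_solved_exists assms iff by blast
  then have "idem_relevant_mgu \<theta> a b"
    using vs unfolding idem_relevant_mgu_def mgu_def is_subst_def eqs_solved_def iff
    by (metis subset_trans)
  then show ?thesis by blast
qed

subsection \<open>Non-variable subterms\<close>

fun nvsub :: "trm \<Rightarrow> trm set" where
  "nvsub (V x) = {}"
| "nvsub (Fn f ts) = insert (Fn f ts) (\<Union> (set (map nvsub ts)))"

fun nvsub_a :: "atom \<Rightarrow> trm set" where
  "nvsub_a (At p ts) = \<Union> (set (map nvsub ts))"

text \<open>Any variable could replace \<open>s\<close>, since afterwards only numbers of function
  symbols (constants included) are compared.\<close>

fun collapse :: "trm \<Rightarrow> trm \<Rightarrow> trm" where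
  "collapse s (V x) = V x"
| "collapse s (Fn f ts) = (if Fn f ts = s then V 0 else Fn f (map (collapse s) ts))"

fun fnum :: "trm \<Rightarrow> nat" where
  "fnum (V x) = 0"
| "fnum (Fn f ts) = Suc (sum_list (map fnum ts))"

lemma fnum_subst: "fnum t \<le> fnum (subst_t \<sigma> t)"
  by (induction t) (auto intro!: sum_list_mono simp: comp_def)

lemma fnum_collapse: "fnum (collapse s t) \<le> fnum t \<and> (s \<in> nvsub t \<longrightarrow> fnum (collapse s t) < fnum t)"
proof (induction t)
  case (Fn f ts)
  show ?case
  proof (cases "Fn f ts = s")
    case False
    have le: "(\<Sum>t\<leftarrow>ts. fnum (collapse s t)) \<le> sum_list (map fnum ts)"
      using Fn by (auto intro!: sum_list_mono)
    have "(\<Sum>t\<leftarrow>ts. fnum (collapse s t)) < sum_list (map fnum ts)" if mem: "s \<in> nvsub (Fn f ts)"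
    proof -
      obtain t where "t \<in> set ts" "s \<in> nvsub t" using mem False by auto
      then obtain us vs where "ts = us @ t # vs" by (meson split_list)
      moreover have "sum_list (map (fnum \<circ> collapse s) us) \<le> sum_list (map fnum us)"
        "sum_list (map (fnum \<circ> collapse s) vs) \<le> sum_list (map fnum vs)"
        using Fn calculation by (auto intro!: sum_list_mono)
      moreover have "fnum (collapse s t) < fnum t"
        using Fn \<open>t \<in> set ts\<close> \<open>s \<in> nvsub t\<close> by blast
      ultimately show ?thesis by (simp add: comp_def)
    qed
    then show ?thesis using False le by (auto simp: comp_def)
  qed auto
qed auto

text \<open>By the hypothesis every occurrence of \<open>s\<close> in the instance lies inside the
  image of a variable, so it may as well be collapsed in \<theta>.\<close>

lemma collapse_subst:
  "s \<notin> subst_t \<theta> ` nvsub t \<Longrightarrow> subst_t (\<lambda>x. collapse s (\<theta> x)) t = collapse s (subst_t \<theta> t)"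
  by (induction t) force+

text \<open>If \<open>s\<close> were not of the stated form, collapsing \<open>s\<close> to a variable would give a unifier
  with fewer function symbols, which is then no instance of \<open>\<theta>\<close>.\<close>
lemma mgu_nvsub:
  assumes "mgu \<theta> a b" "s \<in> nvsub (\<theta> x)"
  shows "s \<in> subst_t \<theta> ` (nvsub_a a \<union> nvsub_a b)"
proof (rule ccontr)
  assume neg: "s \<notin> subst_t \<theta> ` (nvsub_a a \<union> nvsub_a b)"
  let ?\<sigma> = "\<lambda>x. collapse s (\<theta> x)"
  obtain p ts q us where ab: "a = At p ts" "b = At q us" by (cases a, cases b)
  have eq: "p = q" "map (subst_t \<theta>) ts = map (subst_t \<theta>) us"
    using assms(1) ab by (auto simp: mgu_def unifier_def)
  have "map (subst_t ?\<sigma>) ts = map (collapse s) (map (subst_t \<theta>) ts)"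
    using neg ab by (auto intro!: collapse_subst)
  moreover have "map (subst_t ?\<sigma>) us = map (collapse s) (map (subst_t \<theta>) us)"
    using neg ab by (auto intro!: collapse_subst)
  ultimately have "unifier ?\<sigma> a b" using eq ab by (simp add: unifier_def)
  then obtain \<eta> where "?\<sigma> = scomp \<theta> \<eta>" using assms(1) by (auto simp: mgu_def)
  then have "collapse s (\<theta> x) = subst_t \<eta> (\<theta> x)" by (metis scomp_def)
  then show False using fnum_subst[of "\<theta> x" \<eta>] fnum_collapse[of s "\<theta> x"] assms(2) by simp
qed

lemma nvsub_subst: "nvsub (subst_t \<theta> t) \<subseteq> subst_t \<theta> ` nvsub t \<union> (\<Union>x. nvsub (\<theta> x))"
proof (induction t)
  case (Fn f ts)
  have "nvsub (subst_t \<theta> t) \<subseteq> subst_t \<theta> ` nvsub (Fn f ts) \<union> (\<Union>x. nvsub (\<theta> x))"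
    if "t \<in> set ts" for t
  proof -
    have "nvsub t \<subseteq> nvsub (Fn f ts)" using that by auto
    then show ?thesis
      by (rule order_trans[OF Fn[OF that] Un_mono[OF image_mono order_refl]])
  qed
  then have "(\<Union>t\<in>set ts. nvsub (subst_t \<theta> t)) \<subseteq> subst_t \<theta> ` nvsub (Fn f ts) \<union> (\<Union>x. nvsub (\<theta> x))"
    by (rule UN_least)
  moreover have "Fn f (map (subst_t \<theta>) ts) \<in> subst_t \<theta> ` nvsub (Fn f ts)"
    by (intro image_eqI[of _ _ "Fn f ts"]) simp_all
  moreover have "nvsub (subst_t \<theta> (Fn f ts)) =
      insert (Fn f (map (subst_t \<theta>) ts)) (\<Union>t\<in>set ts. nvsub (subst_t \<theta> t))"
    by simp
  ultimately show ?case by (metis UnCI insert_subset)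
qed auto

lemma nvsub_a_subst: "nvsub_a (subst_a \<theta> a) \<subseteq> subst_t \<theta> ` nvsub_a a \<union> (\<Union>x. nvsub (\<theta> x))"
proof (cases a)
  case (At p ts)
  have "nvsub (subst_t \<theta> t) \<subseteq> subst_t \<theta> ` nvsub_a a \<union> (\<Union>x. nvsub (\<theta> x))" if "t \<in> set ts" for t
  proof -
    have "nvsub t \<subseteq> nvsub_a a" using that by (auto simp: At)
    then show ?thesis
      by (rule order_trans[OF nvsub_subst Un_mono[OF image_mono order_refl]])
  qed
  then show ?thesis by (simp add: At UN_subset_iff)
qed

lemma finite_nvsub [simp]: "finite (nvsub t)"
  by (induction t) auto

lemma finite_nvsub_a [simp]: "finite (nvsub_a a)"
  by (cases a) auto

lemma nvsub_size: "s \<in> nvsub t \<Longrightarrow> size s \<le> size t"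
proof (induction t)
  case (Fn f ts)
  show ?case
  proof (cases "s = Fn f ts")
    case False
    then obtain t where t: "t \<in> set ts" "s \<in> nvsub t" using Fn by auto
    then have "size s \<le> size_list size ts" using Fn by (intro size_list_estimation') auto
    then show ?thesis by simp
  qed simp
qed simp

text \<open>A term is larger than its arguments, hence not among their subterms. This makes one
  element of the subterm set disappear at each level of nesting.\<close>

lemma nvsub_arg:
  assumes "t \<in> set ts"
  shows "nvsub t \<subseteq> nvsub (Fn f ts) - {Fn f ts}"
proof -
  have "size t \<le> size_list size ts" using assms by (intro size_list_estimation') auto
  then show ?thesis using assms nvsub_size[of "Fn f ts" t] by auto
qed

subsection \<open>Goals as lists\<close>

definition ordered_as :: "pgoal \<Rightarrow> (atom \<times> rat) list \<Rightarrow> bool" where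
  "ordered_as G xs \<longleftrightarrow> set xs = G \<and> sorted_wrt (<) (map snd xs)"

definition glist :: "pgoal \<Rightarrow> atom list" where
  "glist G = map fst (THE xs. ordered_as G xs)"

lemma ordered_as_exists:
  assumes "pgoal G"
  shows "\<exists>xs. ordered_as G xs"
proof -
  let ?f = "inv_into G snd"
  let ?ps = "sorted_list_of_set (snd ` G)"
  have fin: "finite (snd ` G)" and inj: "inj_on snd G" using assms by (auto simp: pgoal_def)
  have "map snd (map ?f ?ps) = ?ps"
    using fin by (auto intro!: map_idI simp: f_inv_into_f)
  moreover have "set (map ?f ?ps) = G"
    using fin inj by (simp add: image_image inv_into_f_f)
  ultimately have "ordered_as G (map ?f ?ps)"
    unfolding ordered_as_def by (metis strict_sorted_list_of_set)
  then show ?thesis by blast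
qed

lemma ordered_as_inj: "ordered_as G xs \<Longrightarrow> inj_on snd G"
  unfolding ordered_as_def using distinct_map strict_sorted_iff by blast

lemma ordered_as_pgoal: "ordered_as G xs \<Longrightarrow> pgoal G"
  using ordered_as_inj by (auto simp: pgoal_def ordered_as_def)

lemma ordered_as_unique:
  assumes "ordered_as G xs" "ordered_as G ys"
  shows "xs = ys"
proof -
  have "map snd xs = map snd ys"
    using assms by (intro strict_sorted_equal) (auto simp: ordered_as_def)
  then show ?thesis
    using assms ordered_as_inj[OF assms(1)] map_inj_on[of snd xs ys]
    unfolding ordered_as_def by simp
qed

lemma glist_eq: "ordered_as G xs \<Longrightarrow> glist G = map fst xs"
  unfolding glist_def using ordered_as_unique by (subst the_equality[of _ xs]) auto

lemma ordered_as_substg: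
  "ordered_as G xs \<Longrightarrow> ordered_as (substg \<theta> G) (map (\<lambda>(a, p). (subst_a \<theta> a, p)) xs)"
  by (auto simp: ordered_as_def substg_def comp_def case_prod_unfold)

lemma ordered_as_shift:
  "ordered_as G xs \<Longrightarrow> shifting \<pi> \<Longrightarrow> ordered_as (shift \<pi> G) (map (\<lambda>(a, p). (a, \<pi> p)) xs)"
  by (auto simp: ordered_as_def shift_def comp_def case_prod_unfold shifting_def
        sorted_wrt_map strict_mono_less)

lemma pgoal_substg: "pgoal G \<Longrightarrow> pgoal (substg \<theta> G)"
  using ordered_as_exists ordered_as_substg ordered_as_pgoal by blast

lemma pgoal_shift: "pgoal G \<Longrightarrow> shifting \<pi> \<Longrightarrow> pgoal (shift \<pi> G)"
  using ordered_as_exists ordered_as_shift ordered_as_pgoal by blast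

lemma glist_substg:
  assumes "pgoal G"
  shows "glist (substg \<theta> G) = map (subst_a \<theta>) (glist G)"
proof -
  obtain xs where xs: "ordered_as G xs" using ordered_as_exists assms by blast
  show ?thesis using glist_eq[OF xs] glist_eq[OF ordered_as_substg[OF xs]] by auto
qed

lemma glist_shift:
  assumes "pgoal G" "shifting \<pi>"
  shows "glist (shift \<pi> G) = glist G"
proof -
  obtain xs where xs: "ordered_as G xs" using ordered_as_exists assms by blast
  show ?thesis using glist_eq[OF xs] glist_eq[OF ordered_as_shift[OF xs assms(2)]] by auto
qed

lemma set_glist: "pgoal G \<Longrightarrow> set (glist G) = fst ` G"
  using ordered_as_exists[of G] glist_eq[of G] by (metis list.set_map ordered_as_def)

lemma pgoal_subset: "pgoal G \<Longrightarrow> F \<subseteq> G \<Longrightarrow> pgoal F"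
  by (meson finite_subset inj_on_subset pgoal_def)

lemma ordered_as_append:
  "ordered_as F xs \<Longrightarrow> ordered_as G ys \<Longrightarrow> prio_lt F G \<Longrightarrow> ordered_as (F \<union> G) (xs @ ys)"
  by (auto simp: ordered_as_def sorted_wrt_append prio_lt_def prios_def)

lemma glist_Un:
  assumes "pgoal F" "pgoal G" "prio_lt F G"
  shows "glist (F \<union> G) = glist F @ glist G"
proof -
  obtain xs ys where xs: "ordered_as F xs" and ys: "ordered_as G ys"
    using ordered_as_exists assms by blast
  show ?thesis
    using glist_eq[OF xs] glist_eq[OF ys] glist_eq[OF ordered_as_append[OF xs ys assms(3)]] by simp
qed

lemma least_in_unique: "pgoal G \<Longrightarrow> least_in a p G \<Longrightarrow> least_in b q G \<Longrightarrow> (a, p) = (b, q)"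
proof -
  assume "pgoal G" and a: "least_in a p G" and b: "least_in b q G"
  then have "inj_on snd G" by (simp add: pgoal_def)
  moreover have "p = q" using a b by (intro antisym) (force simp: least_in_def prios_def)+
  ultimately show ?thesis using a b by (auto simp: least_in_def dest!: inj_onD[where x = "(a, q)" and y = "(b, q)"])
qed

lemma ordered_as_least:
  assumes "ordered_as G xs" "least_in a p G"
  shows "xs = (a, p) # tl xs" "ordered_as (G - {(a, p)}) (tl xs)"
proof -
  have mem: "(a, p) \<in> set xs" and srt: "sorted_wrt (<) (map snd xs)" and G: "G = set xs"
    using assms by (auto simp: ordered_as_def least_in_def)
  obtain b q ys where xs: "xs = (b, q) # ys" using mem by (cases xs) auto
  have "least_in b q G"
    using srt by (auto simp: least_in_def G xs prios_def intro: less_imp_le)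
  then have "(a, p) = (b, q)" using least_in_unique ordered_as_pgoal assms by blast
  then show "xs = (a, p) # tl xs" "ordered_as (G - {(a, p)}) (tl xs)"
    using srt by (auto simp: xs G ordered_as_def)
qed

lemma glist_least:
  assumes "pgoal G" "least_in a p G"
  shows "glist G = a # glist (G - {(a, p)})"
proof -
  obtain xs where xs: "ordered_as G xs" using ordered_as_exists assms by blast
  show ?thesis
    using glist_eq[OF xs] glist_eq[OF ordered_as_least(2)[OF xs assms(2)]]
      ordered_as_least(1)[OF xs assms(2)] by (metis fst_conv list.simps(9))
qed

lemma least_in_exists:
  assumes "pgoal G" "glist G = a # l"
  shows "\<exists>p. least_in a p G"
proof -
  obtain xs where xs: "ordered_as G xs" using ordered_as_exists assms by blast
  then obtain p ys where "xs = (a, p) # ys" using glist_eq[OF xs] assms(2) by (cases xs) auto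
  then have "least_in a p G"
    using xs by (auto simp: ordered_as_def least_in_def prios_def intro: less_imp_le)
  then show ?thesis by blast
qed

section \<open>Shiftings with prescribed values\<close>

lemma shifting_id: "shifting (\<lambda>x. x)"
  using bij_id by (simp add: shifting_def strict_mono_def id_def)

text \<open>Beyond \<open>x\<close> the map is continued by the line through (x, \<pi> x) and (x',
  y'). Its slope \<open>k\<close> is a positive rational, so the continuation is onto the rationals
  above \<pi> x.\<close>

lemma shifting_extend:
  assumes "shifting \<pi>" "x < x'" "\<pi> x < y'"
  shows "\<exists>\<pi>'. shifting \<pi>' \<and> \<pi>' x' = y' \<and> (\<forall>z\<le>x. \<pi>' z = \<pi> z)"
proof -
  define k where "k = (y' - \<pi> x) / (x' - x)"
  define \<pi>' where "\<pi>' = (\<lambda>z. if z \<le> x then \<pi> z else \<pi> x + (z - x) * k)"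
  have k: "k > 0" using assms by (simp add: k_def)
  have mono: "strict_mono \<pi>" and bij: "bij \<pi>" using assms by (auto simp: shifting_def)
  have "strict_mono \<pi>'"
  proof (rule strict_monoI)
    fix u v :: rat assume uv: "u < v"
    consider "v \<le> x" | "u \<le> x" "x < v" | "x < u" by linarith
    then show "\<pi>' u < \<pi>' v"
    proof cases
      case 1 then show ?thesis using uv mono by (auto simp: \<pi>'_def strict_mono_less)
    next
      case 2
      then have "\<pi> u \<le> \<pi> x" "0 < (v - x) * k" using mono k by (auto simp: strict_mono_less_eq)
      then show ?thesis using 2 by (simp add: \<pi>'_def)
    next
      case 3
      then show ?thesis using uv k by (simp add: \<pi>'_def)
    qed
  qed
  moreover have "surj \<pi>'"
  proof (rule surjI)
    fix y
    show "\<pi>' (if y \<le> \<pi> x then inv \<pi> y else x + (y - \<pi> x) / k) = y"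
    proof (cases "y \<le> \<pi> x")
      case True
      then have "inv \<pi> y \<le> x"
        using mono bij by (metis bij_inv_eq_iff strict_mono_less_eq)
      then show ?thesis using True bij by (simp add: \<pi>'_def bij_is_surj surj_f_inv_f)
    next
      case False
      then have "\<not> (y - \<pi> x) / k \<le> 0" using k by (simp add: not_le)
      then show ?thesis using False k by (simp add: \<pi>'_def)
    qed
  qed
  ultimately have "shifting \<pi>'" by (simp add: shifting_def bij_def strict_mono_imp_inj_on)
  moreover have "\<pi>' x' = y'" using assms by (simp add: \<pi>'_def k_def)
  ultimately show ?thesis by (intro exI[of _ \<pi>']) (auto simp: \<pi>'_def)
qed

lemma shifting_translate: "shifting (\<lambda>x. x + c)"
proof -
  have "surj (\<lambda>x. x + c)" by (rule surjI[of _ "\<lambda>y. y - c"]) simp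
  then show ?thesis by (auto simp: shifting_def strict_mono_def bij_def inj_def)
qed

text \<open>Points are matched in increasing order: beyond the last matched point the shifting can
  still be chosen freely.\<close>

lemma shifting_of_lists:
  "length ps = length qs \<Longrightarrow> sorted_wrt (<) ps \<Longrightarrow> sorted_wrt (<) qs \<Longrightarrow>
     \<exists>\<pi>. shifting \<pi> \<and> map \<pi> ps = qs"
proof (induction ps arbitrary: qs rule: rev_induct)
  case Nil
  then show ?case using shifting_id by auto
next
  case (snoc p ps)
  then obtain q qs' where qs: "qs = qs' @ [q]" by (cases qs rule: rev_cases) auto
  obtain \<pi> where \<pi>: "shifting \<pi>" "map \<pi> ps = qs'"
    using snoc by (auto simp: qs sorted_wrt_append)
  show ?case
  proof (cases ps rule: rev_cases)
    case Nil
    then have "qs' = []" using \<pi> by simp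
    then show ?thesis using shifting_translate[of "q - p"] Nil by (auto simp: qs)
  next
    case (snoc ps' p')
    have "p' < p" "\<pi> p' < q"
      using snoc.prems \<pi> by (auto simp: qs snoc sorted_wrt_append)
    then obtain \<pi>' where \<pi>': "shifting \<pi>'" "\<pi>' p = q" "\<forall>z\<le>p'. \<pi>' z = \<pi> z"
      using shifting_extend \<pi>(1) by blast
    have "\<forall>z\<in>set ps. z \<le> p'"
      using snoc.prems by (auto simp: snoc sorted_wrt_append intro: less_imp_le)
    then have "map \<pi>' ps = map \<pi> ps" using \<pi>' by auto
    then show ?thesis using \<pi>' \<pi> by (auto simp: qs)
  qed
qed

text \<open>Up to shifting a goal is its list of atoms, so priorities can be forgotten until the
  final pruning equation.\<close>

lemma glist_eq_imp_shift:
  assumes "pgoal G" "pgoal H" "glist H = glist G"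
  shows "\<exists>\<pi>. shifting \<pi> \<and> H = shift \<pi> G"
proof -
  obtain xs ys where xs: "ordered_as G xs" and ys: "ordered_as H ys"
    using ordered_as_exists assms by blast
  have fsts: "map fst ys = map fst xs" using glist_eq xs ys assms(3) by metis
  then have "length (map snd xs) = length (map snd ys)" by (metis length_map)
  then obtain \<pi> where \<pi>: "shifting \<pi>" "map \<pi> (map snd xs) = map snd ys"
    using shifting_of_lists[of "map snd xs" "map snd ys"] xs ys by (auto simp: ordered_as_def)
  have "map (\<lambda>(a, p). (a, \<pi> p)) xs = zip (map fst xs) (map \<pi> (map snd xs))"
    by (induction xs) auto
  also have "\<dots> = ys" using fsts \<pi>(2) by (metis zip_map_fst_snd)
  finally have "shift \<pi> G = H" using xs ys by (auto simp: ordered_as_def shift_def)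
  then show ?thesis using \<pi> by blast
qed

definition vars_l :: "atom list \<Rightarrow> nat set" where
  "vars_l l = (\<Union>a\<in>set l. vars_a a)"

lemma finite_vars_l [simp]: "finite (vars_l l)"
  by (simp add: vars_l_def)

lemma vars_g_glist: "pgoal G \<Longrightarrow> vars_g G = vars_l (glist G)"
  by (auto simp: vars_g_def vars_l_def set_glist)

lemma finite_vars_g: "pgoal G \<Longrightarrow> finite (vars_g G)"
  by (simp add: vars_g_glist)

lemma substg_scomp: "substg (scomp \<sigma> \<tau>) G = substg \<tau> (substg \<sigma> G)"
  by (auto simp: substg_def image_image subst_a_scomp case_prod_unfold)

lemma substg_id: "(\<And>x. x \<in> vars_g G \<Longrightarrow> \<sigma> x = V x) \<Longrightarrow> substg \<sigma> G = G"
proof -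
  assume *: "\<And>x. x \<in> vars_g G \<Longrightarrow> \<sigma> x = V x"
  have "subst_a \<sigma> a = a" if "(a, p) \<in> G" for a p
    using that * by (intro subst_a_id) (force simp: vars_g_def)
  then show ?thesis by (force simp: substg_def)
qed

lemma substg_V [simp]: "substg V G = G"
  by (rule substg_id) simp

lemma map_subst_scomp: "map (subst_a (scomp \<sigma> \<tau>)) l = map (subst_a \<tau>) (map (subst_a \<sigma>) l)"
  by (simp add: subst_a_scomp)

subsection \<open>Renamings and infinite paths modulo an equivalence\<close>

text \<open>\<open>X\<close> and its image have equally many elements, so the parts of their union
  outside each of them are matched by a bijection, which closes the partial map to a permutation of
  the union.\<close>

lemma inj_extends_to_permutation:
  fixes X :: "nat set"
  assumes "finite X" "inj_on g X"
  shows "\<exists>f. bij f \<and> finite {x. f x \<noteq> x} \<and> (\<forall>x\<in>X. f x = g x)"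
proof -
  let ?Z = "X \<union> g ` X"
  have fin: "finite ?Z" using assms by simp
  have "card (?Z - X) = card (?Z - g ` X)"
    using assms by (simp add: card_Diff_subset card_image)
  then obtain b where b: "bij_betw b (?Z - X) (?Z - g ` X)"
    using finite_same_card_bij[of "?Z - X" "?Z - g ` X"] fin by auto
  define f where "f = (\<lambda>x. if x \<in> X then g x else if x \<in> ?Z - X then b x else x)"
  have "bij_betw f X (g ` X)"
    using assms by (auto simp: f_def bij_betw_def inj_on_def)
  moreover have "bij_betw f (?Z - X) (?Z - g ` X)"
    using b by (subst bij_betw_cong[of _ f b]) (auto simp: f_def)
  ultimately have "bij_betw f (X \<union> (?Z - X)) (g ` X \<union> (?Z - g ` X))"
    by (rule bij_betw_combine) auto
  then have 1: "bij_betw f ?Z ?Z" by (simp add: Un_Diff_cancel Un_commute Un_left_commute)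
  have 2: "bij_betw f (- ?Z) (- ?Z)" by (subst bij_betw_cong[of _ f id]) (auto simp: f_def)
  have "bij_betw f (?Z \<union> - ?Z) (?Z \<union> - ?Z)" by (rule bij_betw_combine[OF 1 2]) auto
  then have "bij f" by (metis Compl_partition)
  moreover have "{x. f x \<noteq> x} \<subseteq> ?Z" by (auto simp: f_def)
  then have "finite {x. f x \<noteq> x}" using fin finite_subset by blast
  ultimately show ?thesis by (intro exI[of _ f]) (auto simp: f_def)
qed

lemma renaming_inverse:
  assumes "renaming \<rho>"
  shows "\<exists>\<rho>'. renaming \<rho>' \<and> scomp \<rho> \<rho>' = V \<and> scomp \<rho>' \<rho> = V"
proof -
  obtain f where f: "bij f" "finite {x. f x \<noteq> x}" "\<rho> = (\<lambda>x. V (f x))"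
    using assms by (auto simp: renaming_def)
  have inv: "inv f (f x) = x" "f (inv f x) = x" for x
    using f(1) by (auto simp: bij_def surj_f_inv_f)
  have "inv f x \<noteq> x \<Longrightarrow> f x \<noteq> x" for x using inv by metis
  then have "{x. inv f x \<noteq> x} \<subseteq> {x. f x \<noteq> x}" by blast
  then have "renaming (\<lambda>x. V (inv f x))"
    unfolding renaming_def using f bij_imp_bij_inv finite_subset by blast
  then show ?thesis using inv f(3) by (auto simp: scomp_def)
qed

lemma renaming_scomp:
  assumes "renaming \<rho>" "renaming \<sigma>"
  shows "renaming (scomp \<rho> \<sigma>)"
proof -
  obtain f g where f: "bij f" "finite {x. f x \<noteq> x}" "\<rho> = (\<lambda>x. V (f x))"
    and g: "bij g" "finite {x. g x \<noteq> x}" "\<sigma> = (\<lambda>x. V (g x))"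
    using assms by (auto simp: renaming_def)
  have "{x. (g \<circ> f) x \<noteq> x} \<subseteq> {x. f x \<noteq> x} \<union> {x. g x \<noteq> x}" by auto
  then have "finite {x. (g \<circ> f) x \<noteq> x}" using f g by (meson finite_Un finite_subset)
  moreover have "bij (g \<circ> f)" using f g by (simp add: bij_comp)
  ultimately show ?thesis
    unfolding renaming_def by (intro exI[of _ "g \<circ> f"]) (auto simp: f g scomp_def)
qed

lemma vars_g_substg: "vars_g (substg \<xi> B) = (\<Union>x\<in>vars_g B. vars_t (\<xi> x))"
  by (auto simp: vars_g_def substg_def vars_subst_a case_prod_unfold)

lemma vars_c_rename: "vars_c (rename_clause \<xi> c) = (\<Union>x\<in>vars_c c. vars_t (\<xi> x))"
  by (auto simp: vars_c_def rename_clause_def vars_g_substg vars_subst_a)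

lemma finite_vars_c: "is_clause c \<Longrightarrow> finite (vars_c c)"
  by (simp add: vars_c_def is_clause_def finite_vars_g)

lemma finite_vars_c_rename: "is_clause c \<Longrightarrow> finite (vars_c (rename_clause \<xi> c))"
  by (simp add: vars_c_rename finite_vars_c)

text \<open>Adding a strict bound \<open>k\<close> of the forbidden variables moves the clause off
  them. Addition is injective but not onto, hence the extension to a permutation.\<close>

lemma fresh_renaming_exists:
  assumes "is_clause c" "finite U"
  shows "\<exists>\<xi>. renaming \<xi> \<and> vars_c (rename_clause \<xi> c) \<inter> U = {}"
proof -
  obtain k where k: "\<forall>u\<in>U. u < k" using assms(2) finite_nat_set_iff_bounded by blast
  obtain f where f: "bij f" "finite {x. f x \<noteq> x}" "\<forall>x\<in>vars_c c. f x = x + k"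
    using inj_extends_to_permutation[of "vars_c c" "\<lambda>x. x + k"] finite_vars_c[OF assms(1)]
    by (auto simp: inj_on_def)
  have "renaming (\<lambda>x. V (f x))" using f by (auto simp: renaming_def)
  moreover have "vars_c (rename_clause (\<lambda>x. V (f x)) c) \<inter> U = {}"
    using f(3) k by (fastforce simp: vars_c_rename)
  ultimately show ?thesis by blast
qed

section \<open>Koenig's lemma modulo an equivalence\<close>

lemma relpowp_compat:
  assumes compat: "\<And>x x' y. E x x' \<Longrightarrow> R x y \<Longrightarrow> \<exists>y'. R x' y' \<and> E y y'"
  shows "E x x' \<Longrightarrow> (R ^^ n) x y \<Longrightarrow> \<exists>y'. (R ^^ n) x' y' \<and> E y y'"
proof (induction n arbitrary: y)
  case (Suc n)
  then obtain z where z: "(R ^^ n) x z" "R z y" by auto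
  then obtain z' where "(R ^^ n) x' z'" "E z z'" using Suc by blast
  then show ?case using compat[OF _ z(2)] by (meson relpowp_Suc_I)
qed auto

text \<open>Koenig's lemma on the quotient by \<open>E\<close>, along shortest paths from \<open>x0\<close>:
  states of a shortest path are pairwise inequivalent.\<close>
lemma infinite_inequivalent_path:
  fixes R E :: "'a \<Rightarrow> 'a \<Rightarrow> bool"
  assumes E: "equivp E"
    and compat: "\<And>x x' y. E x x' \<Longrightarrow> R x y \<Longrightarrow> \<exists>y'. R x' y' \<and> E y y'"
    and fin: "\<And>x. \<exists>F. finite F \<and> (\<forall>y. R x y \<longrightarrow> (\<exists>f\<in>F. E f y))"
    and infinite: "\<And>F. finite F \<Longrightarrow> \<exists>y. R\<^sup>*\<^sup>* x0 y \<and> (\<forall>f\<in>F. \<not> E f y)"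
  shows "\<exists>f. f 0 = x0 \<and> (\<forall>i. R (f i) (f (Suc i))) \<and> (\<forall>i j. i < j \<longrightarrow> \<not> E (f i) (f j))"
proof -
  note refl = equivp_reflp[OF E] and sym = equivp_symp[OF E] and trans = equivp_transp[OF E]
  have compatn: "\<exists>y'. (R ^^ n) x' y' \<and> E y y'" if "E x x'" "(R ^^ n) x y" for n x x' y
    using relpowp_compat[of E R] compat that by blast
  \<comment> \<open>With distance counted modulo \<open>E\<close>, \<open>T\<close> says that
    \<open>y\<close> is at distance exactly \<open>n\<close> from the start, and \<open>B\<close>
    that a shortest path through \<open>x\<close> goes on for at least \<open>k\<close> steps.
    \<open>Big\<close> is the invariant of the construction: arbitrarily long continuations.\<close>
  define T where "T n y \<longleftrightarrow> (R ^^ n) x0 y \<and> (\<forall>m<n. \<forall>z. (R ^^ m) x0 z \<longrightarrow> \<not> E z y)" for n y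
  define B where "B n x k \<longleftrightarrow> (\<exists>k'\<ge>k. \<exists>m. (R ^^ k') x m \<and> T (n + k') m)" for n x k
  define Big where "Big n x \<longleftrightarrow> T n x \<and> (\<forall>k. B n x k)" for n x
  have level: "\<exists>F. finite F \<and> (\<forall>y. (R ^^ n) x0 y \<longrightarrow> (\<exists>f\<in>F. E f y))" for n
  proof (induction n)
    case 0
    then show ?case using refl by (intro exI[of _ "{x0}"]) auto
  next
    case (Suc n)
    then obtain F where F: "finite F" "\<And>y. (R ^^ n) x0 y \<Longrightarrow> \<exists>f\<in>F. E f y" by blast
    obtain H where H: "\<And>x. finite (H x)" "\<And>x y. R x y \<Longrightarrow> \<exists>f\<in>H x. E f y"
      using fin by metis
    have "\<exists>h\<in>(\<Union>f\<in>F. H f). E h y" if "(R ^^ Suc n) x0 y" for y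
    proof -
      obtain z where z: "(R ^^ n) x0 z" "R z y" using \<open>(R ^^ Suc n) x0 y\<close> by auto
      obtain f where f: "f \<in> F" "E f z" using F z by blast
      obtain y' where y': "R f y'" "E y y'" using compat[OF sym[OF f(2)] z(2)] by blast
      obtain h where "h \<in> H f" "E h y'" using H(2)[OF y'(1)] by blast
      moreover have "E h y" using trans[OF calculation(2) sym[OF y'(2)]] .
      ultimately show ?thesis using f(1) by blast
    qed
    then show ?case using F H by (intro exI[of _ "\<Union>f\<in>F. H f"]) auto
  qed
  have start: "Big 0 x0"
  proof -
    \<comment> \<open>Finitely many classes lie at distance below \<open>k\<close>, so some
      reachable class is farther away; a shortest path to that class has length at least
      \<open>k\<close>.\<close>
    have "B 0 x0 k" for k
    proof -
      obtain L where L: "\<And>n. finite (L n)" "\<And>n y. (R ^^ n) x0 y \<Longrightarrow> \<exists>f\<in>L n. E f y"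
        using level by metis
      obtain y where y: "R\<^sup>*\<^sup>* x0 y" "\<forall>f\<in>(\<Union>n<k. L n). \<not> E f y"
        using infinite[of "\<Union>n<k. L n"] L by auto
      define n where "n = (LEAST n. \<exists>z. (R ^^ n) x0 z \<and> E z y)"
      have ex: "\<exists>n z. (R ^^ n) x0 z \<and> E z y" using y(1) refl by (metis rtranclp_power)
      obtain z where z: "(R ^^ n) x0 z" "E z y" using LeastI_ex[OF ex] n_def by blast
      have least: "\<not> E w y" if "m < n" "(R ^^ m) x0 w" for m w
        using not_less_Least[of m "\<lambda>n. \<exists>z. (R ^^ n) x0 z \<and> E z y"] that n_def by blast
      have "k \<le> n"
      proof (rule ccontr)
        assume "\<not> k \<le> n"
        moreover obtain f where "f \<in> L n" "E f z" using L(2)[OF z(1)] by blast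
        moreover have "E f y" using calculation(3) z(2) by (rule trans)
        ultimately show False using y(2) by auto
      qed
      moreover have "T n z" unfolding T_def using z least by (blast intro: trans)
      ultimately show ?thesis using z(1) unfolding B_def by auto
    qed
    then show ?thesis by (simp add: Big_def T_def)
  qed
  have step: "\<exists>x. R y x \<and> Big (Suc n) x" if y: "Big n y" for n y
  proof -
    obtain F where F: "finite F" "\<And>x. R y x \<Longrightarrow> \<exists>f\<in>F. E f x" using fin by blast
    have anti: "B (Suc n) x k" if "B (Suc n) x k'" "k \<le> k'" for x k k'
      using that le_trans unfolding B_def by blast
    \<comment> \<open>An equivalent successor inherits the continuation: the transported end point
      is equivalent to the old one, and distance depends on the class alone.\<close>
    have cong: "B (Suc n) x' k" if "B (Suc n) x k" "E x x'" "R y x'" for x x' k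
    proof -
      obtain k' m where m: "k' \<ge> k" "(R ^^ k') x m" "T (Suc n + k') m"
        using \<open>B (Suc n) x k\<close> by (auto simp: B_def)
      obtain m' where m': "(R ^^ k') x' m'" "E m m'" using compatn[OF \<open>E x x'\<close> m(2)] by blast
      have "(R ^^ n) x0 y" using y by (simp add: Big_def T_def)
      then have "(R ^^ Suc n) x0 x'" using \<open>R y x'\<close> by auto
      then have "(R ^^ (Suc n + k')) x0 m'" using m'(1) by (metis relpowp_trans)
      then have "T (Suc n + k') m'" using m(3) m'(2) trans sym unfolding T_def by blast
      then show ?thesis using m m' unfolding B_def by blast
    qed
    have ex: "\<exists>f\<in>F. \<exists>x. R y x \<and> E f x \<and> B (Suc n) x k" for k
    proof -
      have "B n y (Suc k)" using y by (simp add: Big_def)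
      then obtain k' m where m: "k' \<ge> Suc k" "(R ^^ k') y m" "T (n + k') m" by (auto simp: B_def)
      then obtain k'' where k'': "k' = Suc k''" by (cases k') auto
      obtain x where x: "R y x" "(R ^^ k'') x m" using m(2) unfolding k'' by (metis relpowp_Suc_E2)
      have "B (Suc n) x k" using x m k'' unfolding B_def by auto
      then show ?thesis using F(2)[OF x(1)] x(1) by blast
    qed
    \<comment> \<open>Pigeonhole over the finitely many successor classes: if each class
      \<open>f\<close> failed at some length \<open>kf f\<close>, the maximum of these lengths would
      contradict \<open>ex\<close>, as \<open>B\<close> is antitone in its last argument.\<close>
    have "\<exists>f\<in>F. \<forall>k. \<exists>x. R y x \<and> E f x \<and> B (Suc n) x k"
    proof (rule ccontr)
      assume "\<not> ?thesis"
      then obtain kf where kf: "\<And>f x. f \<in> F \<Longrightarrow> R y x \<Longrightarrow> E f x \<Longrightarrow> \<not> B (Suc n) x (kf f)" by metis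
      obtain f x where "f \<in> F" "R y x" "E f x" "B (Suc n) x (Max (kf ` F))" using ex by blast
      then show False using kf anti F(1) by (meson Max_ge finite_imageI imageI)
    qed
    then obtain f where f: "\<And>k. \<exists>x. R y x \<and> E f x \<and> B (Suc n) x k" by blast
    obtain x where x: "R y x" "E f x" using f by blast
    have Bx: "B (Suc n) x k" for k
      using f[of k] cong x trans sym by blast
    \<comment> \<open>A shorter route to the class of \<open>x\<close> would shorten the shortest
      path that continues through \<open>x\<close>.\<close>
    have "T (Suc n) x"
    proof -
      have "(R ^^ n) x0 y" using y by (simp add: Big_def T_def)
      then have "(R ^^ Suc n) x0 x" using x by auto
      moreover have False if mz: "m < Suc n" "(R ^^ m) x0 z" "E z x" for m z
      proof -
        obtain k' w where w: "(R ^^ k') x w" "T (Suc n + k') w" using Bx[of 0] by (auto simp: B_def)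
        obtain w' where w': "(R ^^ k') z w'" "E w w'" using compatn[OF sym[OF mz(3)] w(1)] by blast
        have "(R ^^ (m + k')) x0 w'" using mz(2) w'(1) by (metis relpowp_trans)
        moreover have "m + k' < Suc n + k'" using mz(1) by simp
        ultimately show False using w(2) w'(2) sym unfolding T_def by blast
      qed
      ultimately show ?thesis unfolding T_def by blast
    qed
    then show ?thesis using x Bx unfolding Big_def by blast
  qed
  obtain f where f: "\<And>n. Big n (f n) \<and> (n = 0 \<longrightarrow> f n = x0)" "\<And>n. R (f n) (f (Suc n))"
    using dependent_nat_choice[of "\<lambda>n y. Big n y \<and> (n = 0 \<longrightarrow> y = x0)" "\<lambda>n. R"] start step
    by (metis nat.distinct(1))
  have "\<not> E (f i) (f j)" if "i < j" for i j
    using f(1)[of i] f(1)[of j] that unfolding Big_def T_def by blast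
  then show ?thesis using f by blast
qed

subsection \<open>Most general resolvents of atom lists\<close>

text \<open>\<open>ms\<close> and \<open>mq\<close> stand for the stack and the queue part of a
  clause body, so that resolution can be described on lists, without priorities.\<close>

locale split_program =
  fixes P :: "clause set" and ms mq :: "clause \<Rightarrow> atom list"
  assumes program: "program P"
    and split: "c \<in> P \<Longrightarrow> set (ms c) \<union> set (mq c) \<subseteq> fst ` snd c"
begin

text \<open>Goal and clause are instantiated by two independent substitutions. This removes
  standardizing apart from the notion of a step, and candidates of an instance become candidates of
  the original list.\<close>

definition cand :: "clause \<Rightarrow> atom list \<Rightarrow> atom list \<Rightarrow> bool" where
  "cand c l z \<longleftrightarrow> (\<exists>a K \<alpha> \<eta>. l = a # K \<and> subst_a \<alpha> a = subst_a \<eta> (fst c) \<and>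
     z = map (subst_a \<eta>) (ms c) @ map (subst_a \<alpha>) K @ map (subst_a \<eta>) (mq c))"

text \<open>A most general candidate is determined up to mutual instantiation, whatever renaming and
  mgu produced it.\<close>

definition mgstep :: "clause \<Rightarrow> atom list \<Rightarrow> atom list \<Rightarrow> bool" where
  "mgstep c l l' \<longleftrightarrow> cand c l l' \<and> (\<forall>z. cand c l z \<longrightarrow> (\<exists>\<sigma>. z = map (subst_a \<sigma>) l'))"

lemma cand_instance:
  assumes "cand c (map (subst_a \<sigma>) l) z"
  shows "cand c l z"
proof -
  obtain a K \<alpha> \<eta> where *: "map (subst_a \<sigma>) l = a # K" "subst_a \<alpha> a = subst_a \<eta> (fst c)"
    "z = map (subst_a \<eta>) (ms c) @ map (subst_a \<alpha>) K @ map (subst_a \<eta>) (mq c)"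
    using assms by (auto simp: cand_def)
  then obtain b L where "l = b # L" "a = subst_a \<sigma> b" "K = map (subst_a \<sigma>) L" by (cases l) auto
  with * show ?thesis unfolding cand_def
    by (intro exI[of _ b] exI[of _ L] exI[of _ "scomp \<sigma> \<alpha>"] exI[of _ \<eta>])
      (simp add: subst_a_scomp)
qed

lemma clause_P: "c \<in> P \<Longrightarrow> is_clause c"
  using program by (auto simp: program_def)

text \<open>Over disjoint variables the two substitutions of a candidate glue to one: \<alpha> on
  the list, and \<eta> after undoing \<xi> on the renamed clause.\<close>

lemma cand_fresh:
  assumes c: "c \<in> P" and \<xi>: "renaming \<xi>"
    and disj: "vars_l (b # K) \<inter> vars_c (rename_clause \<xi> c) = {}"
    and z: "cand c (b # K) z"
  shows "\<exists>\<sigma>. unifier \<sigma> b (subst_a \<xi> (fst c)) \<and>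
     z = map (subst_a \<sigma>) (map (subst_a \<xi>) (ms c) @ K @ map (subst_a \<xi>) (mq c))"
proof -
  obtain \<alpha> \<eta> where l: "subst_a \<alpha> b = subst_a \<eta> (fst c)"
    "z = map (subst_a \<eta>) (ms c) @ map (subst_a \<alpha>) K @ map (subst_a \<eta>) (mq c)"
    using z by (auto simp: cand_def)
  obtain \<rho> where \<rho>: "scomp \<xi> \<rho> = V" using renaming_inverse \<xi> by blast
  let ?C = "vars_c (rename_clause \<xi> c)"
  define \<sigma> where "\<sigma> = (\<lambda>x. if x \<in> ?C then scomp \<rho> \<eta> x else \<alpha> x)"
  have left: "subst_a \<sigma> u = subst_a \<alpha> u" if "u \<in> set (b # K)" for u
    using that disj by (intro subst_a_cong) (auto simp: \<sigma>_def vars_l_def)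
  have right: "subst_a \<sigma> (subst_a \<xi> u) = subst_a \<eta> u" if "u = fst c \<or> u \<in> fst ` snd c" for u
  proof -
    have "vars_a (subst_a \<xi> u) \<subseteq> ?C"
    proof -
      have "vars_a u \<subseteq> vars_c c" using that by (auto simp: vars_c_def vars_g_def)
      then show ?thesis unfolding vars_c_rename vars_subst_a by (rule UN_mono) simp
    qed
    then have "subst_a \<sigma> (subst_a \<xi> u) = subst_a (scomp \<rho> \<eta>) (subst_a \<xi> u)"
      by (intro subst_a_cong) (auto simp: \<sigma>_def)
    also have "\<dots> = subst_a \<eta> u"
      by (metis \<rho> scomp_V(1) scomp_assoc subst_a_scomp)
    finally show ?thesis .
  qed
  have "unifier \<sigma> b (subst_a \<xi> (fst c))"
    using left[of b] right[of "fst c"] l by (simp add: unifier_def)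
  moreover have "z = map (subst_a \<sigma>) (map (subst_a \<xi>) (ms c) @ K @ map (subst_a \<xi>) (mq c))"
  proof -
    have "map (subst_a \<eta>) (ms c) = map (subst_a \<sigma>) (map (subst_a \<xi>) (ms c))"
      "map (subst_a \<eta>) (mq c) = map (subst_a \<sigma>) (map (subst_a \<xi>) (mq c))"
      using right[symmetric] split[OF c] by (simp_all add: subset_iff)
    moreover have "map (subst_a \<alpha>) K = map (subst_a \<sigma>) K" using left by simp
    ultimately show ?thesis unfolding l by simp
  qed
  ultimately show ?thesis by blast
qed

text \<open>Every candidate comes from a unifier by gluing, and every unifier factors through the
  mgu.\<close>

lemma mgstep_resolvent:
  assumes c: "c \<in> P" and \<xi>: "renaming \<xi>"
    and disj: "vars_l (b # K) \<inter> vars_c (rename_clause \<xi> c) = {}"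
    and mgu: "mgu \<theta> b (subst_a \<xi> (fst c))"
  shows "mgstep c (b # K) (map (subst_a \<theta>) (map (subst_a \<xi>) (ms c) @ K @ map (subst_a \<xi>) (mq c)))"
    (is "mgstep _ _ (map _ ?R)")
proof -
  have "cand c (b # K) (map (subst_a \<theta>) ?R)"
    using mgu unfolding cand_def
    by (intro exI[of _ b] exI[of _ K] exI[of _ \<theta>] exI[of _ "scomp \<xi> \<theta>"])
      (simp add: subst_a_scomp mgu_def unifier_def)
  moreover have "\<exists>\<sigma>. z = map (subst_a \<sigma>) (map (subst_a \<theta>) ?R)" if z: "cand c (b # K) z" for z
  proof -
    obtain \<sigma> where \<sigma>: "unifier \<sigma> b (subst_a \<xi> (fst c))" "z = map (subst_a \<sigma>) ?R"
      using cand_fresh[OF c \<xi> disj z] by blast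
    obtain \<eta> where "\<sigma> = scomp \<theta> \<eta>" using mgu \<sigma>(1) by (auto simp: mgu_def)
    then show ?thesis using \<sigma>(2) map_subst_scomp by blast
  qed
  ultimately show ?thesis by (simp add: mgstep_def)
qed

lemma mgstep_exists:
  assumes c: "c \<in> P" and z: "cand c l z"
  shows "\<exists>l'. mgstep c l l'"
proof -
  obtain b K where l: "l = b # K" using z by (auto simp: cand_def)
  obtain \<xi> where \<xi>: "renaming \<xi>" "vars_c (rename_clause \<xi> c) \<inter> vars_l (b # K) = {}"
    using fresh_renaming_exists[OF clause_P[OF c] finite_vars_l] by blast
  then have disj: "vars_l (b # K) \<inter> vars_c (rename_clause \<xi> c) = {}" by blast
  obtain \<theta> where "idem_relevant_mgu \<theta> b (subst_a \<xi> (fst c))"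
    using cand_fresh[OF c \<xi>(1) disj] z l idem_relevant_mgu_exists by blast
  then show ?thesis
    using mgstep_resolvent[OF c \<xi>(1) disj] l by (auto simp: idem_relevant_mgu_def)
qed

section \<open>Steps on lists modulo variants\<close>

definition lstep :: "atom list \<Rightarrow> atom list \<Rightarrow> bool" where
  "lstep l l' \<longleftrightarrow> (\<exists>c\<in>P. mgstep c l l')"

definition leq_inst :: "atom list \<Rightarrow> atom list \<Rightarrow> bool" where
  "leq_inst l l' \<longleftrightarrow> (\<exists>\<sigma>. l' = map (subst_a \<sigma>) l)"

text \<open>Mutual instantiation takes the place of a renaming: it is visibly an equivalence, and it
  is exactly what relates two most general candidates.\<close>

definition variants :: "atom list \<Rightarrow> atom list \<Rightarrow> bool" where
  "variants l l' \<longleftrightarrow> leq_inst l l' \<and> leq_inst l' l"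

lemma leq_inst_refl: "leq_inst l l"
  unfolding leq_inst_def by (metis subst_a_V' list.map_id)

lemma cand_leq_inst: "leq_inst l m \<Longrightarrow> cand c m z \<Longrightarrow> cand c l z"
  unfolding leq_inst_def using cand_instance by blast

lemma leq_inst_trans: "leq_inst l l' \<Longrightarrow> leq_inst l' l'' \<Longrightarrow> leq_inst l l''"
  unfolding leq_inst_def by (metis map_subst_scomp)

lemma equivp_variants: "equivp variants"
  by (intro equivpI reflpI sympI transpI)
    (auto simp: variants_def leq_inst_refl intro: leq_inst_trans)

lemma variants_length: "variants l l' \<Longrightarrow> length l = length l'"
  by (auto simp: variants_def leq_inst_def)

text \<open>Variants have the same candidates, and two most general members of one set are instances
  of each other.\<close>

lemma mgstep_unique:
  assumes "variants l m" "mgstep c l l'" "mgstep c m m'"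
  shows "variants l' m'"
proof -
  have "cand c l z \<longleftrightarrow> cand c m z" for z
    using assms(1) cand_leq_inst unfolding variants_def by blast
  then show ?thesis using assms(2,3) unfolding mgstep_def variants_def leq_inst_def by blast
qed

lemma mgstep_variants:
  assumes "c \<in> P" "variants l m" "mgstep c l l'"
  shows "\<exists>m'. mgstep c m m' \<and> variants l' m'"
proof -
  have "cand c m l'"
    using assms(2,3) cand_leq_inst unfolding variants_def mgstep_def by blast
  then obtain m' where "mgstep c m m'" using mgstep_exists assms(1) by blast
  then show ?thesis using mgstep_unique assms(2,3) by blast
qed

text \<open>Variants have equal length, so unbounded length means infinitely many classes; branching
  is finite modulo variants because each clause contributes at most one class.\<close>

lemma infinite_path_if_unbounded:
  assumes unbounded: "\<And>n. \<exists>l. lstep\<^sup>*\<^sup>* l0 l \<and> length l > n"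
  shows "\<exists>f. f 0 = l0 \<and> (\<forall>i. lstep (f i) (f (Suc i))) \<and> (\<forall>i j. i < j \<longrightarrow> \<not> variants (f i) (f j))"
proof (rule infinite_inequivalent_path[OF equivp_variants])
  fix x x' y assume "variants x x'" "lstep x y"
  then show "\<exists>y'. lstep x' y' \<and> variants y y'"
    unfolding lstep_def using mgstep_variants by blast
next
  fix x
  let ?F = "(\<lambda>c. SOME y. mgstep c x y) ` P"
  have "\<exists>f\<in>?F. variants f y" if "lstep x y" for y
  proof -
    from that obtain c where c: "c \<in> P" "mgstep c x y" unfolding lstep_def by blast
    have "mgstep c x (SOME y. mgstep c x y)" using c(2) by (rule someI)
    then have "variants (SOME y. mgstep c x y) y"
      using mgstep_unique c(2) equivp_reflp[OF equivp_variants] by blast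
    then show ?thesis using c(1) by blast
  qed
  moreover have "finite ?F" using program by (simp add: program_def)
  ultimately show "\<exists>F. finite F \<and> (\<forall>y. lstep x y \<longrightarrow> (\<exists>f\<in>F. variants f y))" by blast
next
  fix F :: "atom list set" assume F: "finite F"
  obtain l where l: "lstep\<^sup>*\<^sup>* l0 l" "length l > Max (insert 0 (length ` F))" using unbounded by blast
  have "\<not> variants f l" if "f \<in> F" for f
    using that l(2) F variants_length[of f l] Max_ge[of "insert 0 (length ` F)" "length f"] by auto
  then show "\<exists>y. lstep\<^sup>*\<^sup>* l0 y \<and> (\<forall>f\<in>F. \<not> variants f y)" using l(1) by blast
qed

definition reach_inst :: "atom list \<Rightarrow> atom list \<Rightarrow> bool" where
  "reach_inst l0 xs \<longleftrightarrow> (\<exists>l. lstep\<^sup>*\<^sup>* l0 l \<and> leq_inst l xs)"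

definition clause_inst :: "atom \<Rightarrow> atom list \<Rightarrow> atom list \<Rightarrow> bool" where
  "clause_inst a M Q \<longleftrightarrow> (\<exists>c\<in>P. \<exists>\<eta>. a = subst_a \<eta> (fst c) \<and>
     M = map (subst_a \<eta>) (ms c) \<and> Q = map (subst_a \<eta>) (mq c))"

text \<open>Lifting: a clause applied to an instance of a reachable list gives a candidate of that
  list itself, hence an instance of its most general step.\<close>

lemma reach_inst_step:
  assumes "reach_inst l0 (a # K)" "clause_inst a M Q"
  shows "reach_inst l0 (M @ K @ Q)"
proof -
  obtain c \<eta> where c: "c \<in> P" "a = subst_a \<eta> (fst c)" "M = map (subst_a \<eta>) (ms c)"
    "Q = map (subst_a \<eta>) (mq c)" using assms by (auto simp: clause_inst_def)
  obtain l \<sigma> where l: "lstep\<^sup>*\<^sup>* l0 l" "a # K = map (subst_a \<sigma>) l"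
    using assms(1) unfolding reach_inst_def leq_inst_def by metis
  have "cand c (a # K) (M @ K @ Q)"
    unfolding cand_def using c by (intro exI[of _ a] exI[of _ K] exI[of _ V] exI[of _ \<eta>]) simp
  then have "cand c l (M @ K @ Q)" using cand_instance l(2) by simp
  then obtain l' where l': "mgstep c l l'" "leq_inst l' (M @ K @ Q)"
    using mgstep_exists[OF c(1)] unfolding mgstep_def leq_inst_def by blast
  have "lstep l l'" using c(1) l'(1) by (auto simp: lstep_def)
  with l(1) have "lstep\<^sup>*\<^sup>* l0 l'" by (rule rtranclp.rtrancl_into_rtrancl)
  then show ?thesis using l'(2) by (auto simp: reach_inst_def)
qed

lemma reach_inst_subst: "reach_inst l0 xs \<Longrightarrow> reach_inst l0 (map (subst_a \<sigma>) xs)"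
  unfolding reach_inst_def leq_inst_def by (metis map_subst_scomp)

lemma clause_inst_subst:
  "clause_inst a M Q \<Longrightarrow> clause_inst (subst_a \<sigma> a) (map (subst_a \<sigma>) M) (map (subst_a \<sigma>) Q)"
  unfolding clause_inst_def by (metis map_subst_scomp subst_a_scomp)

end

subsection \<open>Simulating reduced derivations\<close>

text \<open>\<open>D\<close> collects the clause instances already used. An atom is covered by \<open>E\<close> if it can be
  resolved away with instances from \<open>D\<close> until only members of \<open>E\<close> (and queue atoms) remain.\<close>
inductive covered :: "(atom \<times> atom list \<times> atom list) set \<Rightarrow> atom set \<Rightarrow> atom \<Rightarrow> bool"
  for D E where
  covered_mem: "a \<in> E \<Longrightarrow> covered D E a"
| covered_clause: "(a, M, Q) \<in> D \<Longrightarrow> (\<And>m. m \<in> set M \<Longrightarrow> covered D E m) \<Longrightarrow> covered D E a"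

text \<open>Covers compose: the end points of an old cover are replaced by covers of their
  own.\<close>

lemma covered_mono:
  assumes "covered D E a" "D \<subseteq> D'" "\<And>e. e \<in> E \<Longrightarrow> covered D' E' e"
  shows "covered D' E' a"
  using assms(1)
proof induction
  case (covered_clause a M Q)
  then show ?case using assms(2) by (blast intro: covered.covered_clause)
qed (use assms(3) in blast)

definition subst_inst ::
    "subst \<Rightarrow> atom \<times> atom list \<times> atom list \<Rightarrow> atom \<times> atom list \<times> atom list" where
  "subst_inst \<sigma> = map_prod (subst_a \<sigma>) (map_prod (map (subst_a \<sigma>)) (map (subst_a \<sigma>)))"

lemma covered_subst:
  "covered D E a \<Longrightarrow> covered (subst_inst \<sigma> ` D) (subst_a \<sigma> ` E) (subst_a \<sigma> a)"
proof (induction rule: covered.induct)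
  case (covered_clause a M Q)
  then have "(subst_a \<sigma> a, map (subst_a \<sigma>) M, map (subst_a \<sigma>) Q) \<in> subst_inst \<sigma> ` D"
    by (force simp: subst_inst_def)
  then show ?case
    by (rule covered.covered_clause) (use covered_clause.IH in auto)
qed (auto intro: covered_mem)

text \<open>Entries marked \<open>True\<close> are the live atoms of the reduced derivation; those marked \<open>False\<close>
  are redundant copies, which must be covered by the live atoms in front of them.\<close>
fun copies_covered :: "(atom \<times> atom list \<times> atom list) set \<Rightarrow> atom set \<Rightarrow> (atom \<times> bool) list \<Rightarrow> bool"
  where
  "copies_covered D E [] = True"
| "copies_covered D E ((a, live) # H) =
     (if live then copies_covered D (insert a E) H else covered D E a \<and> copies_covered D E H)"

abbreviation live :: "(atom \<times> bool) list \<Rightarrow> atom list" where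
  "live H \<equiv> map fst (filter snd H)"

lemma copies_covered_append:
  "copies_covered D E (H @ H') \<longleftrightarrow> copies_covered D E H \<and> copies_covered D (E \<union> set (live H)) H'"
  by (induction D E H rule: copies_covered.induct) auto

lemma copies_covered_mono:
  "copies_covered D E H \<Longrightarrow> D \<subseteq> D' \<Longrightarrow> (\<And>e. e \<in> E \<Longrightarrow> covered D' E' e) \<Longrightarrow> copies_covered D' E' H"
proof (induction D E H arbitrary: E' rule: copies_covered.induct)
  case (2 D E a l H)
  show ?case
  proof (cases l)
    case True
    have "covered D' (insert a E') e" if "e \<in> insert a E" for e
      using that 2(5) covered_mono[of D' E' e D' "insert a E'"] by (auto intro: covered_mem)
    then show ?thesis using True 2(1)[OF True, of "insert a E'"] 2(3,4) by simp
  next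
    case False
    then show ?thesis using 2 covered_mono by (metis copies_covered.simps(2))
  qed
qed simp

lemma copies_covered_subst:
  "copies_covered D E H \<Longrightarrow>
     copies_covered (subst_inst \<sigma> ` D) (subst_a \<sigma> ` E) (map (map_prod (subst_a \<sigma>) id) H)"
  by (induction D E H rule: copies_covered.induct) (auto simp: covered_subst split: if_splits)

lemma copies_covered_live [simp]: "copies_covered D E (map (\<lambda>a. (a, True)) L)"
  by (induction L arbitrary: E) auto

lemma copies_covered_copies [simp]:
  "copies_covered D E (map (\<lambda>a. (a, False)) L) \<longleftrightarrow> (\<forall>a\<in>set L. covered D E a)"
  by (induction L) auto

lemma live_live [simp]: "live (map (\<lambda>a. (a, True)) L) = L"
  by (induction L) auto

lemma live_copies [simp]: "live (map (\<lambda>a. (a, False)) L) = []"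
  by (induction L) auto

text \<open>\<open>E\<close> collects the atoms kept so far. A later duplicate may be kept too,
  since a reduction is free to eliminate only some of them.\<close>

fun drops_duplicates :: "atom set \<Rightarrow> (atom \<times> bool) list \<Rightarrow> bool" where
  "drops_duplicates E [] = True"
| "drops_duplicates E ((a, keep) # xs) =
     (if keep then drops_duplicates (insert a E) xs else a \<in> E \<and> drops_duplicates E xs)"

lemma drops_duplicates_set:
  "drops_duplicates E xs \<Longrightarrow> fst ` set xs \<subseteq> E \<union> set (live xs)"
  by (induction E xs rule: drops_duplicates.induct) (auto split: if_splits)

text \<open>Eliminating a duplicate only changes its mark: the entry stays in the simulating list,
  covered outright by the equal live atom before it.\<close>

lemma copies_covered_drop:
  "copies_covered D E H \<Longrightarrow> live H = map fst xs \<Longrightarrow> drops_duplicates E xs \<Longrightarrow>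
     \<exists>H'. map fst H' = map fst H \<and> live H' = live xs \<and> copies_covered D E H'"
proof (induction D E H arbitrary: xs rule: copies_covered.induct)
  case (1 D E)
  then show ?case by (intro exI[of _ "[]"]) auto
next
  case (2 D E a l H)
  show ?case
  proof (cases l)
    case True
    then obtain k xs' where xs: "xs = (a, k) # xs'" using 2(4) by (cases xs) auto
    define E' where "E' = insert a E"
    have dd: "drops_duplicates E' xs'" and E': "k \<or> E' = E"
      using 2(5) by (auto simp: xs E'_def insert_absorb split: if_splits)
    obtain H' where "map fst H' = map fst H" "live H' = live xs'" "copies_covered D E' H'"
      using 2(1)[OF True, of xs'] 2(3,4) True dd by (auto simp: xs E'_def)
    then show ?thesis using E'
      by (intro exI[of _ "(a, k) # H'"]) (auto simp: xs E'_def intro: covered_mem)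
  next
    case False
    then obtain H' where "map fst H' = map fst H" "live H' = live xs" "copies_covered D E H'"
      using 2(2)[OF False, of xs] 2(3-5) by auto
    then show ?thesis using False 2(3) by (intro exI[of _ "(a, False) # H'"]) auto
  qed
qed

context split_program begin

text \<open>\<open>L\<close> is matched by a longer list that is an instance of a list reachable without
  reductions.\<close>
definition simulated :: "atom list \<Rightarrow> atom list \<Rightarrow> bool" where
  "simulated l0 L \<longleftrightarrow> (\<exists>D H. reach_inst l0 (map fst H) \<and> L = live H \<and> copies_covered D {} H \<and>
     (\<forall>(a, M, Q)\<in>D. clause_inst a M Q \<and> (\<forall>x\<in>set Q. covered D (set L) x)))"

lemma simulated_refl: "simulated l0 l0"
proof -
  have "reach_inst l0 l0" using leq_inst_refl by (auto simp: reach_inst_def)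
  then show ?thesis
    unfolding simulated_def by (intro exI[of _ "{}"] exI[of _ "map (\<lambda>a. (a, True)) l0"]) (auto simp: comp_def)
qed

lemma simulated_subst:
  assumes "simulated l0 L"
  shows "simulated l0 (map (subst_a \<sigma>) L)"
proof -
  obtain D H where H: "reach_inst l0 (map fst H)" "L = live H" "copies_covered D {} H"
    and D: "\<And>a M Q. (a, M, Q) \<in> D \<Longrightarrow> clause_inst a M Q"
      "\<And>a M Q x. (a, M, Q) \<in> D \<Longrightarrow> x \<in> set Q \<Longrightarrow> covered D (set L) x"
    using assms unfolding simulated_def by fast
  let ?D = "subst_inst \<sigma> ` D" and ?H = "map (map_prod (subst_a \<sigma>) id) H"
  have "map fst ?H = map (subst_a \<sigma>) (map fst H)" by simp
  then have "reach_inst l0 (map fst ?H)" using reach_inst_subst[OF H(1)] by metis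
  moreover have "map (subst_a \<sigma>) L = live ?H" by (simp add: H(2) filter_map comp_def)
  moreover have "copies_covered ?D {} ?H" using copies_covered_subst[OF H(3)] by simp
  moreover have "clause_inst a M Q \<and> (\<forall>x\<in>set Q. covered ?D (set (map (subst_a \<sigma>) L)) x)"
    if "(a, M, Q) \<in> ?D" for a M Q
    using that D covered_subst[of D "set L" _ \<sigma>] clause_inst_subst by (auto simp: subst_inst_def)
  ultimately show ?thesis unfolding simulated_def by blast
qed

lemma simulated_drop:
  assumes "simulated l0 (map fst xs)" "drops_duplicates {} xs"
  shows "simulated l0 (live xs)"
proof -
  obtain D H where H: "reach_inst l0 (map fst H)" "map fst xs = live H" "copies_covered D {} H"
    and D: "\<forall>(a, M, Q)\<in>D. clause_inst a M Q \<and> (\<forall>x\<in>set Q. covered D (set (map fst xs)) x)"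
    using assms(1) unfolding simulated_def by blast
  obtain H' where H': "map fst H' = map fst H" "live H' = live xs" "copies_covered D {} H'"
    using copies_covered_drop[OF H(3) H(2)[symmetric] assms(2)] by blast
  \<comment> \<open>Every dropped atom keeps an equal live one, so the covers of the queue atoms of
    \<open>D\<close> remain valid.\<close>
  have "set (map fst xs) = set (live xs)" using drops_duplicates_set[OF assms(2)] by auto
  then show ?thesis
    using H H' D unfolding simulated_def by (intro exI[of _ D] exI[of _ H']) simp
qed

text \<open>A cover with no end points is a finite tree of used instances and is replayed by
  induction on it. Stack atoms come to the front and are resolved at once in the same way; queue
  atoms go to the end, where the hypothesis on \<open>D\<close> covers them.\<close>

lemma resolve_copy:
  assumes D: "\<And>a M Q. (a, M, Q) \<in> D \<Longrightarrow> clause_inst a M Q"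
      "\<And>a M Q x. (a, M, Q) \<in> D \<Longrightarrow> x \<in> set Q \<Longrightarrow> covered D A x"
  shows "covered D {} a \<Longrightarrow> reach_inst l0 (a # K) \<Longrightarrow>
     \<exists>Z. reach_inst l0 (K @ Z) \<and> (\<forall>z\<in>set Z. covered D A z)"
proof (induction arbitrary: K rule: covered.induct)
  case (covered_clause a M Q)
  have "\<exists>Z. reach_inst l0 (K @ Z) \<and> (\<forall>z\<in>set Z. covered D A z)"
    if "set M' \<subseteq> set M" "reach_inst l0 (M' @ K)" for M' K
    using that
  proof (induction M' arbitrary: K)
    case Nil
    then show ?case by (intro exI[of _ "[]"]) auto
  next
    case (Cons m M')
    then obtain Z where Z: "reach_inst l0 ((M' @ K) @ Z)" "\<forall>z\<in>set Z. covered D A z"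
      using covered_clause.IH[of m "M' @ K"] by auto
    then obtain Z' where "reach_inst l0 ((K @ Z) @ Z')" "\<forall>z\<in>set Z'. covered D A z"
      using Cons.IH[of "K @ Z"] Cons.prems by auto
    then show ?case using Z by (intro exI[of _ "Z @ Z'"]) auto
  qed
  moreover have "reach_inst l0 (M @ K @ Q)"
    using reach_inst_step covered_clause.prems covered_clause.hyps(1) D(1) by blast
  ultimately obtain Z where "reach_inst l0 ((K @ Q) @ Z)" "\<forall>z\<in>set Z. covered D A z" by blast
  then show ?case using D(2)[OF covered_clause.hyps(1)] by (intro exI[of _ "Q @ Z"]) auto
qed simp

text \<open>Copies before the first live atom have covers without end points and are replayed in
  turn, \<open>Z\<close> collecting the queue atoms left behind. When the live atom is reached,
  \<open>Z\<close> joins the list as further copies; all live atoms precede it, so its covers are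
  admissible.\<close>

lemma resolve_copies:
  assumes D: "\<And>a M Q. (a, M, Q) \<in> D \<Longrightarrow> clause_inst a M Q"
      "\<And>a M Q x. (a, M, Q) \<in> D \<Longrightarrow> x \<in> set Q \<Longrightarrow> covered D (set (live H)) x"
  shows "reach_inst l0 (map fst H @ Z) \<Longrightarrow> copies_covered D {} H \<Longrightarrow>
     \<forall>z\<in>set Z. covered D (set (live H)) z \<Longrightarrow> live H = a # K \<Longrightarrow>
     \<exists>H'. reach_inst l0 (a # map fst H') \<and> K = live H' \<and> copies_covered D {a} H'"
  using D
proof (induction H arbitrary: Z)
  case (Cons x H)
  obtain b l where x: "x = (b, l)" by (cases x)
  show ?case
  proof (cases l)
    case True
    have ba: "b = a" and K: "K = live H" using Cons.prems(4) x True by auto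
    have "copies_covered D {a} H" using Cons.prems(2) x True ba by simp
    moreover have "insert a (set (live H)) = set (live (x # H))" using x True ba by simp
    ultimately have "copies_covered D {a} (H @ map (\<lambda>z. (z, False)) Z)"
      using Cons.prems(3) by (simp add: copies_covered_append)
    moreover have "reach_inst l0 (a # map fst (H @ map (\<lambda>z. (z, False)) Z))"
      using Cons.prems(1) x ba by (simp add: comp_def)
    ultimately show ?thesis using K by (intro exI[of _ "H @ map (\<lambda>z. (z, False)) Z"]) simp
  next
    case False
    have cov: "covered D {} b" "copies_covered D {} H" using Cons.prems(2) x False by auto
    have lv: "live (x # H) = live H" using x False by simp
    have "reach_inst l0 (b # (map fst H @ Z))" using Cons.prems(1) x by simp
    from resolve_copy[of D "set (live H)", OF _ _ cov(1) this] Cons.prems(5,6)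
    obtain Z' where "reach_inst l0 ((map fst H @ Z) @ Z')" "\<forall>z\<in>set Z'. covered D (set (live H)) z"
      unfolding lv by metis
    then show ?thesis
      using Cons.IH[of "Z @ Z'"] cov(2) Cons.prems(3-6) unfolding lv by auto
  qed
qed simp

text \<open>Resolving \<open>a\<close> removes an end point of covers. Recording the instance in
  \<open>D\<close> makes \<open>a\<close> itself covered by its stack atoms, which now stand where
  \<open>a\<close> stood, so old covers are grafted onto this one. The queue atoms of the new
  instance are live themselves.\<close>

lemma simulated_step:
  assumes "simulated l0 (a # K)" "clause_inst a M Q"
  shows "simulated l0 (M @ K @ Q)"
proof -
  obtain D H where H: "reach_inst l0 (map fst H)" "live H = a # K" "copies_covered D {} H"
    and D: "\<And>a M Q. (a, M, Q) \<in> D \<Longrightarrow> clause_inst a M Q"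
      "\<And>b M Q x. (b, M, Q) \<in> D \<Longrightarrow> x \<in> set Q \<Longrightarrow> covered D (set (a # K)) x"
    using assms(1) unfolding simulated_def by (metis (no_types, lifting) case_prodD)
  obtain H1 where H1: "reach_inst l0 (a # map fst H1)" "K = live H1" "copies_covered D {a} H1"
    using resolve_copies[of D H l0 "[]" a K] H D by auto
  let ?D = "insert (a, M, Q) D"
  let ?H = "map (\<lambda>a. (a, True)) M @ H1 @ map (\<lambda>a. (a, True)) Q"
  have a: "covered ?D E a" if "set M \<subseteq> E" for E
    using that by (intro covered_clause[of a M Q]) (auto intro: covered_mem)
  have "reach_inst l0 (map fst ?H)"
    using reach_inst_step[OF H1(1) assms(2)] by (simp add: comp_def)
  moreover have "M @ K @ Q = live ?H" by (simp add: H1(2) comp_def)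
  moreover have "copies_covered ?D (set M) H1"
    by (rule copies_covered_mono[OF H1(3)]) (auto intro: a)
  then have "copies_covered ?D {} ?H" by (simp add: copies_covered_append)
  moreover have "covered ?D (set (M @ K @ Q)) x" if "covered D (set (a # K)) x" for x
    using that by (rule covered_mono) (auto intro: a covered_mem)
  then have "\<forall>(b, M', Q')\<in>?D. clause_inst b M' Q' \<and> (\<forall>x\<in>set Q'. covered ?D (set (M @ K @ Q)) x)"
    using D assms(2) by (auto intro: covered_mem)
  ultimately show ?thesis unfolding simulated_def by blast
qed

lemma simulated_length:
  assumes "simulated l0 L"
  shows "\<exists>l. lstep\<^sup>*\<^sup>* l0 l \<and> length L \<le> length l"
proof -
  obtain H where H: "reach_inst l0 (map fst H)" "L = live H"
    using assms unfolding simulated_def by blast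
  obtain l \<sigma> where l: "lstep\<^sup>*\<^sup>* l0 l" "map fst H = map (subst_a \<sigma>) l"
    using H(1) unfolding reach_inst_def leq_inst_def by metis
  have "length H = length l" using l(2) by (metis length_map)
  then show ?thesis using l(1) H(2) length_filter_le[of snd H] by auto
qed

end

section \<open>Reduced goals as lists\<close>

text \<open>As \<tau> fixes the variables of \<open>N\<close>, kept atoms are their own instances
  and eliminated ones become equal to their representatives, so the minimal priority belongs to an
  element of the instantiated goal. The second claim keeps \<tau> out of the accumulated
  substitution later on.\<close>

lemma reduced_subset:
  assumes G: "pgoal G" and red: "reduced G \<tau> N X"
  shows "N \<subseteq> substg \<tau> G" "fst ` N \<subseteq> fst ` G"
    "\<And>b q. (b, q) \<in> substg \<tau> G \<Longrightarrow> \<exists>q'\<le>q. (b, q') \<in> N"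
proof -
  from red obtain F A and h :: nat and a p r where
    Geq: "G = F \<union> (\<lambda>j. (a j, p j)) ` {..<h} \<union> (\<Union>j<h. A j)"
    and A': "\<forall>j<h. \<forall>(b, q)\<in>A j. subst_a \<tau> b = a j"
    and r': "\<forall>j<h. r j = Min ({p j} \<union> prios (A j))"
    and N: "N = F \<union> (\<lambda>j. (a j, r j)) ` {..<h}"
    and fixed: "\<forall>x\<in>X \<union> vars_g N. \<tau> x = V x"
    unfolding reduced_def by (elim conjE exE) (rule that)
  have A: "subst_a \<tau> b = a j" if "j < h" "(b, q) \<in> A j" for j b q using A' that by blast
  have r: "r j = Min ({p j} \<union> prios (A j))" if "j < h" for j using r' that by blast
  have fixN: "subst_a \<tau> b = b" if "(b, q) \<in> N" for b q
    using that fixed by (intro subst_a_id) (force simp: vars_g_def)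
  have finA: "finite (prios (A j))" if "j < h" for j
    using G that by (auto simp: pgoal_def Geq prios_def)
  have r_in: "r j = p j \<or> (\<exists>b. (b, r j) \<in> A j)" if "j < h" for j
    using Min_in[of "{p j} \<union> prios (A j)"] finA[OF that] r[OF that] by (auto simp: prios_def)
  have r_le: "r j \<le> p j" "(b, q) \<in> A j \<Longrightarrow> r j \<le> q" if "j < h" for j b q
    using finA[OF that] r[OF that] by (force simp: prios_def intro: Min_le)+
  have aj: "subst_a \<tau> (a j) = a j" if "j < h" for j
    using fixN that by (auto simp: N)
  have sub: "(subst_a \<tau> b, q) \<in> substg \<tau> G" if "(b, q) \<in> G" for b q
    using that by (force simp: substg_def)
  show "N \<subseteq> substg \<tau> G"
  proof
    fix x assume x: "x \<in> N"
    obtain b q where bq: "x = (b, q)" by (cases x)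
    consider "(b, q) \<in> F" | j where "j < h" "b = a j" "q = r j" using x by (auto simp: bq N)
    then show "x \<in> substg \<tau> G"
    proof cases
      case 1
      then have "(b, q) \<in> G" by (simp add: Geq)
      then show ?thesis using sub[of b q] fixN[of b q] x bq by simp
    next
      case 2
      then have "(a j, p j) \<in> G" by (auto simp: Geq)
      moreover have "(c, r j) \<in> G" if "(c, r j) \<in> A j" for c using that 2 by (auto simp: Geq)
      ultimately show ?thesis using r_in[OF 2(1)] sub A[OF 2(1)] aj[OF 2(1)] 2 bq by metis
    qed
  qed
  show "fst ` N \<subseteq> fst ` G" by (force simp: N Geq)
  fix b q assume "(b, q) \<in> substg \<tau> G"
  then obtain c where c: "(c, q) \<in> G" "b = subst_a \<tau> c" by (auto simp: substg_def)
  then consider "(c, q) \<in> F" | j where "j < h" "c = a j" "q = p j" | j where "j < h" "(c, q) \<in> A j"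
    by (auto simp: Geq)
  then show "\<exists>q'\<le>q. (b, q') \<in> N"
  proof cases
    case 1
    then show ?thesis using c fixN[of c q] by (auto simp: N)
  next
    case 2
    then show ?thesis using c aj r_le by (auto simp: N)
  next
    case 3
    then have "(b, r j) \<in> N" "r j \<le> q" using c(2) A r_le(2) by (auto simp: N)
    then show ?thesis by blast
  qed
qed

text \<open>The equal atom in \<open>N\<close> of an eliminated one has a strictly smaller priority,
  as the eliminated one is not in \<open>N\<close>; hence it stands earlier in the sorted
  list.\<close>

lemma drops_duplicates_sorted:
  "sorted_wrt (<) (map snd ys) \<Longrightarrow>
     \<forall>(b, q)\<in>set ys. b \<in> E \<or> (\<exists>q'\<le>q. (b, q') \<in> N \<inter> set ys) \<Longrightarrow>
     drops_duplicates E (map (\<lambda>(b, q). (b, (b, q) \<in> N)) (ys :: (atom \<times> rat) list))"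
proof (induction ys arbitrary: E)
  case (Cons y ys)
  obtain b q where y: "y = (b, q)" by (cases y)
  have gt: "q < q'" if "(b', q') \<in> set ys" for b' q' using Cons.prems(1) that by (force simp: y)
  show ?case
  proof (cases "y \<in> N")
    case True
    have "\<forall>(b', q)\<in>set ys. b' \<in> insert b E \<or> (\<exists>q'\<le>q. (b', q') \<in> N \<inter> set ys)"
      using Cons.prems(2) by (fastforce simp: y)
    then show ?thesis using Cons True by (simp add: y)
  next
    case False
    have "b \<in> E" using Cons.prems(2) gt False by (fastforce simp: y)
    moreover have "\<forall>(b', q)\<in>set ys. b' \<in> E \<or> (\<exists>q'\<le>q. (b', q') \<in> N \<inter> set ys)"
      using Cons.prems(2) False by (fastforce simp: y)
    ultimately show ?thesis using Cons False by (simp add: y)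
  qed
qed simp

lemma reduced_glist:
  assumes G: "pgoal G" and red: "reduced G \<tau> N X"
  shows "pgoal N \<and> (\<exists>xs. map fst xs = map (subst_a \<tau>) (glist G) \<and> glist N = live xs \<and>
     drops_duplicates {} xs)"
proof -
  note sub = reduced_subset[OF G red]
  obtain ys where ys: "ordered_as (substg \<tau> G) ys" using ordered_as_exists pgoal_substg G by blast
  let ?xs = "map (\<lambda>(b, q). (b, (b, q) \<in> N)) ys"
  have "ordered_as N (filter (\<lambda>y. y \<in> N) ys)"
    using ys sub(1) unfolding ordered_as_def by (auto simp: sorted_wrt_map sorted_wrt_filter)
  then have pN: "pgoal N" and N: "glist N = map fst (filter (\<lambda>y. y \<in> N) ys)"
    by (rule ordered_as_pgoal, rule glist_eq)
  have "live ?xs = map fst (filter (\<lambda>y. y \<in> N) ys)" by (induction ys) auto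
  moreover have "map fst ?xs = map (subst_a \<tau>) (glist G)"
    using glist_eq[OF ys] glist_substg[OF G, of \<tau>] by (simp add: comp_def case_prod_unfold)
  moreover have "drops_duplicates {} ?xs"
  proof (rule drops_duplicates_sorted)
    show "sorted_wrt (<) (map snd ys)" using ys by (simp add: ordered_as_def)
    have set: "set ys = substg \<tau> G" using ys by (simp add: ordered_as_def)
    then have "N \<inter> set ys = N" using sub(1) by blast
    moreover have "\<forall>(b, q)\<in>set ys. \<exists>q'\<le>q. (b, q') \<in> N"
      unfolding set by (rule ballI) (rule case_prodI2, use sub(3) in blast)
    ultimately show "\<forall>(b, q)\<in>set ys. b \<in> {} \<or> (\<exists>q'\<le>q. (b, q') \<in> N \<inter> set ys)"
      by simp
  qed
  ultimately show ?thesis using pN N by (intro conjI exI[of _ ?xs]) simp_all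
qed

subsection \<open>Derivations via a stack-queue rule\<close>

lemma prios_shift_substg [simp]: "prios (shift \<pi> (substg \<xi> B)) = \<pi> ` prios B"
  by (force simp: prios_def shift_def substg_def)

lemma pgoal_Un: "pgoal F \<Longrightarrow> pgoal G \<Longrightarrow> prio_disj F G \<Longrightarrow> pgoal (F \<union> G)"
  unfolding pgoal_def prio_disj_def prios_def inj_on_Un by blast

lemma vars_g_shift: "vars_g (shift \<pi> G) = vars_g G"
  by (force simp: vars_g_def shift_def)

lemma step_sh_pgoal:
  assumes "step_sh G c \<xi> \<theta> \<pi> R"
  shows "pgoal R"
proof -
  obtain a p where *: "pgoal G" "is_clause c" "shifting \<pi>"
    "prio_disj (G - {(a, p)}) (shift \<pi> (substg \<xi> (snd c)))"
    "R = substg \<theta> ((G - {(a, p)}) \<union> shift \<pi> (substg \<xi> (snd c)))"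
    using assms by (auto simp: step_sh_def)
  have "pgoal (G - {(a, p)})" using pgoal_subset[OF *(1)] by blast
  moreover have "pgoal (shift \<pi> (substg \<xi> (snd c)))"
    using * by (intro pgoal_shift pgoal_substg) (auto simp: is_clause_def)
  ultimately show ?thesis using * by (simp add: pgoal_substg pgoal_Un)
qed

lemma step_sh_vars:
  assumes "step_sh G c \<xi> \<theta> \<pi> R"
  shows "vars_g R \<subseteq> vars_g G \<union> vars_c (rename_clause \<xi> c)"
proof -
  let ?C = "vars_c (rename_clause \<xi> c)"
  obtain a p where *: "least_in a p G" "idem_relevant_mgu \<theta> a (subst_a \<xi> (fst c))"
    "R = substg \<theta> ((G - {(a, p)}) \<union> shift \<pi> (substg \<xi> (snd c)))"
    using assms by (auto simp: step_sh_def)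
  have "svars \<theta> \<subseteq> vars_a a \<union> vars_a (subst_a \<xi> (fst c))"
    using *(2) by (simp add: idem_relevant_mgu_def)
  moreover have "vars_a a \<subseteq> vars_g G" using *(1) by (force simp: least_in_def vars_g_def)
  moreover have "vars_a (subst_a \<xi> (fst c)) \<subseteq> ?C" by (auto simp: vars_c_def rename_clause_def)
  ultimately have sv: "svars \<theta> \<subseteq> vars_g G \<union> ?C" by blast
  have \<theta>: "vars_t (\<theta> x) \<subseteq> insert x (svars \<theta>)" for x
    by (cases "x \<in> sdom \<theta>") (auto simp: svars_def sdom_def)
  have "vars_g ((G - {(a, p)}) \<union> shift \<pi> (substg \<xi> (snd c)))
      \<subseteq> vars_g G \<union> vars_g (shift \<pi> (substg \<xi> (snd c)))"
    by (auto simp: vars_g_def)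
  also have "\<dots> \<subseteq> vars_g G \<union> ?C" by (auto simp: vars_g_shift vars_c_def rename_clause_def)
  finally show ?thesis unfolding *(3) vars_g_substg using \<theta> sv by blast
qed

text \<open>With identical instantiation, empty \<open>X\<close> and the same shifting, lowering
  merely exchanges renaming and mgu. Closure under this is what permits fresh clause variables
  within a complete set.\<close>

lemma congr_lowering_same_goal:
  assumes s1: "step_sh G c \<xi> \<theta> \<pi> R" and s2: "step_sh G c \<xi>' \<theta>' \<pi> R'"
  shows "congr_lowering (Step G c \<xi>' \<theta>' R') (Step G c \<xi> \<theta> R)"
proof -
  obtain a p where a: "least_in a p G" "R' = substg \<theta>' ((G - {(a, p)}) \<union> shift \<pi> (substg \<xi>' (snd c)))"
    using s2 by (auto simp: step_sh_def)
  have [simp]: "shift (\<lambda>x. x) K = K" for K by (simp add: shift_def)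
  have "insert (a, p) (G - {(a, p)}) = G" using a(1) by (auto simp: least_in_def)
  moreover have "is_subst V" by (simp add: is_subst_def sdom_def)
  ultimately show ?thesis
    unfolding congr_lowering_def using s1 s2 a shifting_id
    by (intro conjI exI[of _ a] exI[of _ p] exI[of _ "G - {(a, p)}"] exI[of _ "{}"] exI[of _ V]
        exI[of _ "\<lambda>x. x"] exI[of _ \<pi>]) (simp_all add: prio_disj_def prios_def)
qed

lemma shifting_avoids:
  assumes "finite X" "finite Y"
  shows "\<exists>\<pi>. shifting \<pi> \<and> X \<inter> \<pi> ` Y = {}"
proof -
  let ?C = "Max (insert 0 X) - Min (insert 0 Y) + 1"
  have "x < y + ?C" if "x \<in> X" "y \<in> Y" for x y
  proof -
    have "x \<le> Max (insert 0 X)" "Min (insert 0 Y) \<le> y"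
      using assms that by (intro Max_ge Min_le; simp)+
    then show ?thesis by linarith
  qed
  then show ?thesis using shifting_translate[of ?C] by (intro exI[of _ "\<lambda>x. x + ?C"]) fastforce
qed

locale stack_queue_derivations = split_program +
  fixes SQ :: "step set"
  assumes complete: "complete_steps SQ"
    and resolvent: "Step G c \<xi> \<theta> R \<in> SQ \<Longrightarrow> c \<in> P \<Longrightarrow>
      glist R = map (subst_a \<theta>) (map (subst_a \<xi>) (ms c) @ tl (glist G) @ map (subst_a \<xi>) (mq c))"
begin

lemma SQ_valid: "s \<in> SQ \<Longrightarrow> valid_step s"
  using complete by (auto simp: complete_steps_def)

text \<open>Completeness promises only some step for the given goal and clause, and only if a valid
  one exists, which is constructed first. The step obtained lends its shifting to a step with the
  fresh renaming; the two are congruent lowerings of each other.\<close>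

lemma fresh_step_exists:
  assumes G: "pgoal G" and c: "c \<in> P" and z: "cand c (glist G) z" and U: "finite U"
  shows "\<exists>\<xi> \<theta> R. Step G c \<xi> \<theta> R \<in> SQ \<and> vars_c (rename_clause \<xi> c) \<inter> U = {}"
proof -
  obtain \<xi> where \<xi>: "renaming \<xi>" "vars_c (rename_clause \<xi> c) \<inter> (U \<union> vars_g G) = {}"
    using fresh_renaming_exists[OF clause_P[OF c], of "U \<union> vars_g G"] U finite_vars_g[OF G] by auto
  obtain a K where aK: "glist G = a # K" using z by (auto simp: cand_def)
  obtain p where p: "least_in a p G" using least_in_exists[OF G aK] by blast
  have "vars_l (a # K) \<inter> vars_c (rename_clause \<xi> c) = {}"
    using \<xi>(2) vars_g_glist[OF G] aK by auto
  then obtain \<theta> where \<theta>: "idem_relevant_mgu \<theta> a (subst_a \<xi> (fst c))"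
    using cand_fresh[OF c \<xi>(1)] z aK idem_relevant_mgu_exists by metis
  let ?K = "G - {(a, p)}"
  have step: "step_sh G c \<xi> \<theta> \<pi> (substg \<theta> (?K \<union> shift \<pi> (substg \<xi> (snd c))))"
    if "shifting \<pi>" "prios ?K \<inter> \<pi> ` prios (snd c) = {}" for \<pi>
    unfolding step_sh_def prio_disj_def
    using G clause_P[OF c] p \<xi> \<theta> that by (intro conjI exI[of _ a] exI[of _ p]) auto
  have "finite (prios ?K)" "finite (prios (snd c))"
    using G clause_P[OF c] by (auto simp: prios_def pgoal_def is_clause_def)
  then have "\<exists>\<xi> \<theta> R. valid_step (Step G c \<xi> \<theta> R)"
    using shifting_avoids step unfolding valid_step_def step.sel by meson
  then obtain \<xi>0 \<theta>0 R0 where s0: "Step G c \<xi>0 \<theta>0 R0 \<in> SQ"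
    using complete unfolding complete_steps_def by blast
  then obtain \<pi> where \<pi>: "step_sh G c \<xi>0 \<theta>0 \<pi> R0" using SQ_valid by (force simp: valid_step_def)
  then obtain b q where "least_in b q G" "shifting \<pi>" "prios (G - {(b, q)}) \<inter> \<pi> ` prios (snd c) = {}"
    by (auto simp: step_sh_def prio_disj_def)
  moreover have "(b, q) = (a, p)" using least_in_unique[OF G] p calculation(1) by blast
  ultimately have "step_sh G c \<xi> \<theta> \<pi> (substg \<theta> (?K \<union> shift \<pi> (substg \<xi> (snd c))))"
    using step by simp
  then have "mutual_congr_lowering (Step G c \<xi>0 \<theta>0 R0)
     (Step G c \<xi> \<theta> (substg \<theta> (?K \<union> shift \<pi> (substg \<xi> (snd c)))))"
    unfolding mutual_congr_lowering_def using congr_lowering_same_goal \<pi> by blast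
  then have "Step G c \<xi> \<theta> (substg \<theta> (?K \<union> shift \<pi> (substg \<xi> (snd c)))) \<in> SQ"
    using complete s0 unfolding complete_steps_def by blast
  then show ?thesis using \<xi>(2) by blast
qed

lemma SQ_mgstep:
  assumes s: "Step G c \<xi> \<theta> R \<in> SQ" and c: "c \<in> P"
  shows "mgstep c (glist G) (glist R)"
proof -
  obtain \<pi> a p where *: "pgoal G" "least_in a p G" "renaming \<xi>"
    "vars_g G \<inter> vars_c (rename_clause \<xi> c) = {}" "idem_relevant_mgu \<theta> a (subst_a \<xi> (fst c))"
    using SQ_valid[OF s] by (auto simp: valid_step_def step_sh_def)
  let ?K = "glist (G - {(a, p)})"
  have l: "glist G = a # ?K" using glist_least * by blast
  have "mgstep c (a # ?K) (map (subst_a \<theta>) (map (subst_a \<xi>) (ms c) @ ?K @ map (subst_a \<xi>) (mq c)))"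
    using * l vars_g_glist[OF *(1)] by (intro mgstep_resolvent[OF c]) (auto simp: idem_relevant_mgu_def)
  then show ?thesis using resolvent[OF s c] l by simp
qed

lemma SQ_step_facts:
  assumes "Step G c \<xi> \<theta> R \<in> SQ"
  shows "pgoal G" "pgoal R" "vars_g R \<subseteq> vars_g G \<union> vars_c (rename_clause \<xi> c)"
proof -
  obtain \<pi> where \<pi>: "step_sh G c \<xi> \<theta> \<pi> R"
    using SQ_valid[OF assms] by (auto simp: valid_step_def)
  show "pgoal G" using \<pi> by (simp add: step_sh_def)
  show "pgoal R" "vars_g R \<subseteq> vars_g G \<union> vars_c (rename_clause \<xi> c)"
    using step_sh_pgoal[OF \<pi>] step_sh_vars[OF \<pi>] by auto
qed

text \<open>The lists of an SLD derivation determine each other up to variants, so any sequence of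
  lists is realised by a derivation with fresh clauses.\<close>
lemma derivation_of_path:
  assumes G0: "pgoal G0" and f0: "f 0 = glist G0" and f: "\<And>i. lstep (f i) (f (Suc i))"
  shows "\<exists>s. inf_psld P SQ G0 s \<and> (\<forall>i. variants (f i) (glist (sgoal (s i))))"
proof -
  obtain d where d: "\<And>i. d i \<in> P" "\<And>i. mgstep (d i) (f i) (f (Suc i))"
    using f unfolding lstep_def by metis
  define cv where "cv s = vars_c (rename_clause (sren s) (scl s))" for s
  \<comment> \<open>\<open>U\<close> accumulates the variables of the initial goal and of all
    earlier clauses. As mgus are relevant, it also contains those of the current goal, so avoiding
    \<open>U\<close> suffices for the next clause.\<close>
  define Inv where "Inv n su \<longleftrightarrow> (case su of (s, U) \<Rightarrow> s \<in> SQ \<and> scl s = d n \<and>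
      variants (f n) (glist (sgoal s)) \<and> finite U \<and> vars_g (sgoal s) \<subseteq> U \<and> cv s \<inter> U = {} \<and>
      (n = 0 \<longrightarrow> sgoal s = G0 \<and> U = vars_g G0))" for n and su :: "step \<times> nat set"
  define Next where "Next su su' \<longleftrightarrow> sgoal (fst su') = sres (fst su) \<and> snd su' = snd su \<union> cv (fst su)"
    for su su' :: "step \<times> nat set"
  have make: "\<exists>s. s \<in> SQ \<and> scl s = d n \<and> sgoal s = G \<and> cv s \<inter> U = {}"
    if v: "variants (f n) (glist G)" and G: "pgoal G" and U: "finite U" for n G U
  proof -
    obtain z where "cand (d n) (glist G) z"
      using mgstep_variants[OF d(1) v d(2)] unfolding mgstep_def by blast
    from fresh_step_exists[OF G d(1) this U] obtain \<xi> \<theta> R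
      where "Step G (d n) \<xi> \<theta> R \<in> SQ" "vars_c (rename_clause \<xi> (d n)) \<inter> U = {}" by blast
    then show ?thesis by (intro exI[of _ "Step G (d n) \<xi> \<theta> R"]) (simp add: cv_def)
  qed
  have start: "\<exists>su. Inv 0 su"
  proof -
    have v: "variants (f 0) (glist G0)" using equivp_reflp[OF equivp_variants] f0 by simp
    then obtain s where "s \<in> SQ" "scl s = d 0" "sgoal s = G0" "cv s \<inter> vars_g G0 = {}"
      using make[OF v G0 finite_vars_g[OF G0]] by blast
    then have "Inv 0 (s, vars_g G0)" using v finite_vars_g[OF G0] by (simp add: Inv_def)
    then show ?thesis ..
  qed
  have step: "\<exists>su'. Inv (Suc n) su' \<and> Next su su'" if inv: "Inv n su" for n su
  proof -
    obtain s U where su: "su = (s, U)" by (cases su)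
    obtain G c \<xi> \<theta> R where s: "s = Step G c \<xi> \<theta> R" by (cases s)
    have I: "Step G c \<xi> \<theta> R \<in> SQ" "c = d n" "variants (f n) (glist G)" "finite U" "vars_g G \<subseteq> U"
      using inv by (auto simp: Inv_def su s)
    note facts = SQ_step_facts[OF I(1)]
    have v: "variants (f (Suc n)) (glist R)"
      using mgstep_unique[OF I(3) d(2)] SQ_mgstep[OF I(1)] d(1) I(2) by simp
    have U: "finite (U \<union> cv s)"
      using I(4) finite_vars_c_rename[OF clause_P[OF d(1)[of n]]] I(2) by (simp add: cv_def s)
    obtain s' where s': "s' \<in> SQ" "scl s' = d (Suc n)" "sgoal s' = R" "cv s' \<inter> (U \<union> cv s) = {}"
      using make[OF v facts(2) U] by blast
    have "vars_g R \<subseteq> U \<union> cv s" using facts(3) I(5) by (auto simp: cv_def s)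
    then have "Inv (Suc n) (s', U \<union> cv s)" using s' v U by (simp add: Inv_def)
    moreover have "Next su (s', U \<union> cv s)" using s'(3) by (simp add: Next_def su s)
    ultimately show ?thesis by blast
  qed
  obtain F where F: "\<And>n. Inv n (F n)" "\<And>n. Next (F n) (F (Suc n))"
    using dependent_nat_choice[of Inv "\<lambda>_. Next"] start step by metis
  let ?s = "\<lambda>n. fst (F n)"
  have U: "snd (F n) = vars_g G0 \<union> (\<Union>i<n. cv (?s i))" for n
  proof (induction n)
    case 0
    then show ?case using F(1)[of 0] by (simp add: Inv_def split_beta)
  next
    case (Suc n)
    then show ?case using F(2)[of n] by (auto simp: Next_def lessThan_Suc)
  qed
  have "inf_psld P SQ G0 ?s"
    unfolding inf_psld_def
  proof (intro conjI allI)
    show "sgoal (?s 0) = G0" using F(1)[of 0] by (simp add: Inv_def split_beta)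
    fix j
    have I: "?s j \<in> SQ" "scl (?s j) = d j" "cv (?s j) \<inter> snd (F j) = {}"
      using F(1)[of j] by (simp_all add: Inv_def split_beta)
    show "?s j \<in> SQ" "valid_step (?s j)" "scl (?s j) \<in> P" using I SQ_valid d(1) by auto
    show "sgoal (?s (Suc j)) = sres (?s j)" using F(2)[of j] by (simp add: Next_def)
    show "vars_c (rename_clause (sren (?s j)) (scl (?s j))) \<inter>
        (vars_g G0 \<union> (\<Union>i<j. vars_c (rename_clause (sren (?s i)) (scl (?s i))))) = {}"
      using I(3) U[of j] by (simp add: cv_def)
  qed
  moreover have "variants (f i) (glist (sgoal (?s i)))" for i
    using F(1)[of i] by (simp add: Inv_def split_beta)
  ultimately show ?thesis by blast
qed

text \<open>Pruning would make two goals of the realised derivation variants of each other, which a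
  path of pairwise inequivalent lists excludes.\<close>

lemma reachable_bounded:
  assumes G0: "pgoal G0"
    and pruned: "\<And>s. inf_psld P SQ G0 s \<Longrightarrow> pruned_EVR G0 (\<lambda>j. smgu (s j)) (\<lambda>j. sgoal (s j))"
  shows "\<exists>B. \<forall>l. lstep\<^sup>*\<^sup>* (glist G0) l \<longrightarrow> length l \<le> B"
proof (rule ccontr)
  assume "\<nexists>B. \<forall>l. lstep\<^sup>*\<^sup>* (glist G0) l \<longrightarrow> length l \<le> B"
  then have "\<exists>l. lstep\<^sup>*\<^sup>* (glist G0) l \<and> length l > n" for n by (meson not_le)
  then obtain f where f: "f 0 = glist G0" "\<And>i. lstep (f i) (f (Suc i))"
    "\<And>i j. i < j \<Longrightarrow> \<not> variants (f i) (f j)"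
    using infinite_path_if_unbounded by meson
  obtain s where s: "inf_psld P SQ G0 s" "\<And>i. variants (f i) (glist (sgoal (s i)))"
    using derivation_of_path[OF G0 f(1,2)] by blast
  obtain i j \<tau> \<pi> where ij: "i < j" "renaming \<tau>" "shifting \<pi>"
    "sgoal (s j) = shift \<pi> (substg \<tau> (sgoal (s i)))"
    using pruned[OF s(1)] by (auto simp: pruned_EVR_def)
  have pg: "pgoal (sgoal (s i))"
    using s(1) SQ_step_facts(1) by (metis inf_psld_def step.collapse)
  have eq: "glist (sgoal (s j)) = map (subst_a \<tau>) (glist (sgoal (s i)))"
    using ij pg by (simp add: glist_shift glist_substg pgoal_substg)
  obtain \<tau>' where \<tau>': "scomp \<tau> \<tau>' = V" using renaming_inverse ij(2) by blast
  have "glist (sgoal (s i)) = map (subst_a \<tau>') (glist (sgoal (s j)))"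
    unfolding eq map_subst_scomp[symmetric] \<tau>' by simp
  then have "variants (glist (sgoal (s i))) (glist (sgoal (s j)))"
    using eq by (auto simp: variants_def leq_inst_def)
  then have "variants (f i) (f j)"
    using s(2) equivp_symp[OF equivp_variants] equivp_transp[OF equivp_variants] by meson
  then show False using f(3) ij(1) by blast
qed

text \<open>A derivation step is split in two: \<theta> instantiates the whole simulation, then a
  clause instance with head equal to the first atom replaces that atom without instantiating
  anything further.\<close>

lemma prsld_simulated:
  assumes G0: "pgoal G0" and D: "inf_prsld P SQ G0 G N \<alpha> s"
  shows "pgoal (G j) \<and> simulated (glist G0) (glist (G j))"
    and "pgoal (N j) \<and> simulated (glist G0) (glist (N j))"
proof -
  have step: "s j \<in> SQ" "scl (s j) \<in> P" "sgoal (s j) = N j" "sres (s j) = G (Suc j)"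
    "reduced (G j) (\<alpha> j) (N j) (vars_g (sub_upto (\<lambda>i. smgu (s i)) j G0))" for j
    using D by (auto simp: inf_prsld_def)
  have red: "pgoal (N j) \<and> simulated (glist G0) (glist (N j))"
    if Gj: "pgoal (G j)" "simulated (glist G0) (glist (G j))" for j
  proof -
    obtain xs where xs: "map fst xs = map (subst_a (\<alpha> j)) (glist (G j))"
      "glist (N j) = live xs" "drops_duplicates {} xs" and N: "pgoal (N j)"
      using reduced_glist[OF Gj(1) step(5)] by blast
    have "simulated (glist G0) (map fst xs)" using simulated_subst[OF Gj(2)] xs(1) by metis
    then show ?thesis using simulated_drop xs N by metis
  qed
  have G: "pgoal (G j) \<and> simulated (glist G0) (glist (G j))" for j
  proof (induction j)
    case 0
    then show ?case using G0 D simulated_refl by (simp add: inf_prsld_def)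
  next
    case (Suc j)
    obtain c \<xi> \<theta> where s: "s j = Step (N j) c \<xi> \<theta> (G (Suc j))"
      using step(3,4)[of j] by (metis step.collapse)
    have sj: "Step (N j) c \<xi> \<theta> (G (Suc j)) \<in> SQ" "c \<in> P" using step(1,2)[of j] s by simp_all
    have N: "pgoal (N j)" "simulated (glist G0) (glist (N j))" using red Suc by auto
    obtain \<pi> a p where *: "least_in a p (N j)" "idem_relevant_mgu \<theta> a (subst_a \<xi> (fst c))"
      using SQ_valid[OF sj(1)] by (auto simp: valid_step_def step_sh_def)
    let ?K = "glist (N j - {(a, p)})"
    have l: "glist (N j) = a # ?K" using glist_least N * by blast
    have "simulated (glist G0) (subst_a \<theta> a # map (subst_a \<theta>) ?K)"
      using simulated_subst[OF N(2), of \<theta>] l by simp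
    moreover have "clause_inst (subst_a \<theta> a) (map (subst_a \<theta>) (map (subst_a \<xi>) (ms c)))
        (map (subst_a \<theta>) (map (subst_a \<xi>) (mq c)))"
      unfolding clause_inst_def using sj(2) *(2)
      by (intro bexI[of _ c] exI[of _ "scomp \<xi> \<theta>"])
        (auto simp: subst_a_scomp idem_relevant_mgu_def mgu_def unifier_def)
    ultimately have "simulated (glist G0) (glist (G (Suc j)))"
      using simulated_step resolvent[OF sj] l by simp
    then show ?case using SQ_step_facts(2)[OF sj(1)] by simp
  qed
  show "pgoal (G j) \<and> simulated (glist G0) (glist (G j))" by (rule G)
  show "pgoal (N j) \<and> simulated (glist G0) (glist (N j))" using red G by blast
qed

end

subsection \<open>Finiteness up to variants\<close>

text \<open>A symbol may occur with several numbers of arguments, so \<Sigma> consists of pairs of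
  symbol and arity.\<close>

fun terms_upto :: "(nat \<times> nat) set \<Rightarrow> nat set \<Rightarrow> nat \<Rightarrow> trm set" where
  "terms_upto \<Sigma> X 0 = V ` X"
| "terms_upto \<Sigma> X (Suc n) =
     V ` X \<union> {Fn f ts | f ts. (f, length ts) \<in> \<Sigma> \<and> set ts \<subseteq> terms_upto \<Sigma> X n}"

definition atoms_upto :: "(nat \<times> nat) set \<Rightarrow> (nat \<times> nat) set \<Rightarrow> nat set \<Rightarrow> nat \<Rightarrow> atom set" where
  "atoms_upto \<Pi> \<Sigma> X n = {At p ts | p ts. (p, length ts) \<in> \<Pi> \<and> set ts \<subseteq> terms_upto \<Sigma> X n}"

lemma finite_applications:
  assumes "finite \<Sigma>" "finite T"
  shows "finite {C f ts | f ts. (f, length ts) \<in> \<Sigma> \<and> set ts \<subseteq> T}"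
proof -
  have "{C f ts | f ts. (f, length ts) \<in> \<Sigma> \<and> set ts \<subseteq> T}
      \<subseteq> (\<Union>(f, k)\<in>\<Sigma>. C f ` {ts. set ts \<subseteq> T \<and> length ts = k})" by fastforce
  moreover have "finite (\<Union>(f, k)\<in>\<Sigma>. C f ` {ts. set ts \<subseteq> T \<and> length ts = k})"
    using assms by (auto intro!: finite_imageI finite_lists_length_eq)
  ultimately show ?thesis by (rule finite_subset)
qed

lemma finite_terms_upto: "finite \<Sigma> \<Longrightarrow> finite X \<Longrightarrow> finite (terms_upto \<Sigma> X n)"
  by (induction n) (auto intro!: finite_applications)

lemma finite_atoms_upto: "finite \<Pi> \<Longrightarrow> finite \<Sigma> \<Longrightarrow> finite X \<Longrightarrow> finite (atoms_upto \<Pi> \<Sigma> X n)"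
  unfolding atoms_upto_def by (intro finite_applications finite_terms_upto)

lemma card_UN_set_le:
  fixes w :: nat
  assumes "\<And>t. t \<in> set ts \<Longrightarrow> card (A t) \<le> w"
  shows "card (\<Union>t\<in>set ts. A t) \<le> length ts * w"
proof -
  have "card (\<Union>t\<in>set ts. A t) \<le> (\<Sum>t\<in>set ts. card (A t))" by (rule card_UN_le) simp
  also have "\<dots> \<le> card (set ts) * w" using assms by (metis sum_bounded_above of_nat_id)
  also have "\<dots> \<le> length ts * w" by (simp add: card_length)
  finally show ?thesis .
qed

lemma arity_bounded:
  assumes "finite (\<Sigma> :: (nat \<times> nat) set)"
  shows "\<exists>r. \<forall>(f, k)\<in>\<Sigma>. k \<le> r"
proof -
  have "k \<le> Max (snd ` \<Sigma>)" if "(f, k) \<in> \<Sigma>" for f k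
    using assms that by (intro Max_ge) force+
  then show ?thesis by blast
qed

text \<open>\<open>X\<close> may be infinite: depth and arities alone limit how many variables one
  term contains.\<close>

lemma terms_upto_vars_bounded:
  assumes "finite \<Sigma>"
  shows "\<exists>w. \<forall>t\<in>terms_upto \<Sigma> X n. card (vars_t t) \<le> w"
proof (induction n)
  case 0
  then show ?case by (intro exI[of _ 1]) auto
next
  case (Suc n)
  then obtain w where w: "\<And>t. t \<in> terms_upto \<Sigma> X n \<Longrightarrow> card (vars_t t) \<le> w" by blast
  obtain r where r: "\<And>f k. (f, k) \<in> \<Sigma> \<Longrightarrow> k \<le> r" using arity_bounded[OF assms] by blast
  have "card (vars_t t) \<le> max 1 (r * w)" if t: "t \<in> terms_upto \<Sigma> X (Suc n)" for t
  proof (cases t)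
    case (Fn f ts)
    then have ts: "(f, length ts) \<in> \<Sigma>" "set ts \<subseteq> terms_upto \<Sigma> X n" using t by auto
    have "card (vars_t t) \<le> length ts * w"
      unfolding Fn using card_UN_set_le[of ts vars_t w] w ts(2) by auto
    also have "\<dots> \<le> r * w" using r[OF ts(1)] by simp
    finally show ?thesis by simp
  qed simp
  then show ?case by blast
qed

lemma atoms_upto_vars_bounded:
  assumes "finite \<Pi>" "finite \<Sigma>"
  shows "\<exists>w. \<forall>a\<in>atoms_upto \<Pi> \<Sigma> X n. card (vars_a a) \<le> w"
proof -
  obtain w where w: "\<And>t. t \<in> terms_upto \<Sigma> X n \<Longrightarrow> card (vars_t t) \<le> w"
    using terms_upto_vars_bounded[OF assms(2)] by blast
  obtain r where r: "\<And>f k. (f, k) \<in> \<Pi> \<Longrightarrow> k \<le> r" using arity_bounded[OF assms(1)] by blast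
  have "card (vars_a a) \<le> r * w" if a: "a \<in> atoms_upto \<Pi> \<Sigma> X n" for a
  proof -
    obtain p ts where ts: "a = At p ts" "(p, length ts) \<in> \<Pi>" "set ts \<subseteq> terms_upto \<Sigma> X n"
      using a by (auto simp: atoms_upto_def)
    have "card (vars_a a) \<le> length ts * w"
      unfolding ts(1) using card_UN_set_le[of ts vars_t w] w ts(3) by auto
    also have "\<dots> \<le> r * w" using r[OF ts(2)] by simp
    finally show ?thesis .
  qed
  then show ?thesis by blast
qed

lemma terms_upto_rename:
  "t \<in> terms_upto \<Sigma> X n \<Longrightarrow> f ` vars_t t \<subseteq> Y \<Longrightarrow> subst_t (\<lambda>x. V (f x)) t \<in> terms_upto \<Sigma> Y n"
proof (induction n arbitrary: t)
  case (Suc n)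
  show ?case
  proof (cases t)
    case (Fn g ts)
    then have "set ts \<subseteq> terms_upto \<Sigma> X n" "(g, length ts) \<in> \<Sigma>" using Suc.prems by auto
    then show ?thesis using Suc Fn by fastforce
  qed (use Suc.prems in auto)
qed auto

lemma atoms_upto_rename:
  assumes "a \<in> atoms_upto \<Pi> \<Sigma> X n" "f ` vars_a a \<subseteq> Y"
  shows "subst_a (\<lambda>x. V (f x)) a \<in> atoms_upto \<Pi> \<Sigma> Y n"
proof -
  obtain p ts where ts: "a = At p ts" "(p, length ts) \<in> \<Pi>" "set ts \<subseteq> terms_upto \<Sigma> X n"
    using assms by (auto simp: atoms_upto_def)
  have "subst_t (\<lambda>x. V (f x)) t \<in> terms_upto \<Sigma> Y n" if "t \<in> set ts" for t
    using that ts assms(2) by (intro terms_upto_rename) auto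
  then show ?thesis using ts by (auto simp: atoms_upto_def)
qed

text \<open>At most \<open>m\<close> atoms with at most \<open>w\<close> variables each allow every
  list to be renamed into \<open>m * w\<close> fixed variables. Only finitely many lists exist over
  these, and a repetition is transported back by an inverse renaming.\<close>

lemma finitely_many_variants:
  fixes st :: "nat \<Rightarrow> atom list"
  assumes fin: "finite \<Pi>" "finite \<Sigma>" and len: "\<And>j. length (st j) \<le> m"
    and st: "\<And>j. set (st j) \<subseteq> atoms_upto \<Pi> \<Sigma> UNIV n"
  shows "\<exists>i j \<tau>. i < j \<and> renaming \<tau> \<and> st j = map (subst_a \<tau>) (st i)"
proof -
  obtain w where w: "\<And>a. a \<in> atoms_upto \<Pi> \<Sigma> UNIV n \<Longrightarrow> card (vars_a a) \<le> w"
    using atoms_upto_vars_bounded[OF fin] by blast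
  let ?Y = "{..<m * w}"
  let ?F = "{l. set l \<subseteq> atoms_upto \<Pi> \<Sigma> ?Y n \<and> length l \<le> m}"
  have "\<exists>\<rho>. renaming \<rho> \<and> map (subst_a \<rho>) (st j) \<in> ?F" for j
  proof -
    let ?X = "vars_l (st j)"
    have "card ?X \<le> length (st j) * w"
      unfolding vars_l_def using w st[of j] by (intro card_UN_set_le) auto
    also have "\<dots> \<le> card ?Y" using len[of j] by simp
    finally obtain g where g: "g ` ?X \<subseteq> ?Y" "inj_on g ?X"
      using card_le_inj[of ?X ?Y] by auto
    obtain f where f: "bij f" "finite {x. f x \<noteq> x}" "\<forall>x\<in>?X. f x = g x"
      using inj_extends_to_permutation[OF finite_vars_l g(2)] by blast
    have "subst_a (\<lambda>x. V (f x)) a \<in> atoms_upto \<Pi> \<Sigma> ?Y n" if "a \<in> set (st j)" for a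
    proof (rule atoms_upto_rename)
      show "a \<in> atoms_upto \<Pi> \<Sigma> UNIV n" using st that by blast
      show "f ` vars_a a \<subseteq> ?Y" using that f(3) g(1) by (auto simp: vars_l_def image_subset_iff)
    qed
    moreover have "renaming (\<lambda>x. V (f x))" using f by (auto simp: renaming_def)
    ultimately show ?thesis using len[of j] by (intro exI[of _ "\<lambda>x. V (f x)"]) auto
  qed
  then obtain \<rho> where \<rho>: "\<And>j. renaming (\<rho> j)" "\<And>j. map (subst_a (\<rho> j)) (st j) \<in> ?F" by metis
  have "finite ?F" using fin by (intro finite_lists_length_le finite_atoms_upto) auto
  then have "\<not> inj (\<lambda>j. map (subst_a (\<rho> j)) (st j))"
    using \<rho>(2) finite_subset[of "range (\<lambda>j. map (subst_a (\<rho> j)) (st j))" ?F]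
      finite_imageD[of _ "UNIV :: nat set"] by (metis (no_types, lifting) image_subsetI infinite_UNIV_nat)
  then obtain i j where "i \<noteq> j" "map (subst_a (\<rho> i)) (st i) = map (subst_a (\<rho> j)) (st j)"
    by (auto simp: inj_def)
  then obtain i j where ij: "i < j" "map (subst_a (\<rho> i)) (st i) = map (subst_a (\<rho> j)) (st j)"
    by (metis linorder_neqE_nat)
  obtain \<rho>' where \<rho>': "renaming \<rho>'" "scomp (\<rho> j) \<rho>' = V" using renaming_inverse \<rho>(1) by blast
  have "st j = map (subst_a (scomp (\<rho> j) \<rho>')) (st j)" by (simp add: \<rho>'(2))
  also have "\<dots> = map (subst_a (scomp (\<rho> i) \<rho>')) (st i)" unfolding map_subst_scomp ij(2) ..
  finally show ?thesis using ij(1) renaming_scomp[OF \<rho>(1) \<rho>'(1)] by blast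
qed

text \<open>Depth is bounded by counting: each compound term is removed from \<open>S\<close> before
  its arguments are examined, so nesting stops after at most \<open>card S\<close> levels.\<close>

lemma terms_upto_of_nvsub:
  "nvsub t \<subseteq> S \<Longrightarrow> finite S \<Longrightarrow> card S \<le> n \<Longrightarrow> \<forall>f ts. Fn f ts \<in> S \<longrightarrow> (f, length ts) \<in> \<Sigma> \<Longrightarrow>
     t \<in> terms_upto \<Sigma> UNIV n"
proof (induction n arbitrary: t S)
  case 0
  then show ?case by (cases t) auto
next
  case (Suc n)
  show ?case
  proof (cases t)
    case (Fn f ts)
    then have mem: "Fn f ts \<in> S" using Suc.prems by auto
    have "u \<in> terms_upto \<Sigma> UNIV n" if "u \<in> set ts" for u
    proof (rule Suc.IH[of u "S - {Fn f ts}"])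
      show "nvsub u \<subseteq> S - {Fn f ts}" using nvsub_arg[OF that, of f] Suc.prems(1) Fn by blast
    qed (use Suc.prems mem in auto)
    then show ?thesis using mem Suc.prems(4) Fn by auto
  qed simp
qed

fun pred_arity :: "atom \<Rightarrow> nat \<times> nat" where
  "pred_arity (At p ts) = (p, length ts)"

lemma pred_arity_subst [simp]: "pred_arity (subst_a \<sigma> a) = pred_arity a"
  by (cases a) simp

lemma atoms_upto_of_nvsub:
  assumes "nvsub_a a \<subseteq> S" "finite S" "card S \<le> n" "\<forall>f ts. Fn f ts \<in> S \<longrightarrow> (f, length ts) \<in> \<Sigma>"
    "pred_arity a \<in> \<Pi>"
  shows "a \<in> atoms_upto \<Pi> \<Sigma> UNIV n"
proof -
  obtain p ts where a: "a = At p ts" by (cases a)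
  have "t \<in> terms_upto \<Sigma> UNIV n" if "t \<in> set ts" for t
    using assms that by (intro terms_upto_of_nvsub[of t S]) (auto simp: a)
  then show ?thesis using assms(5) by (auto simp: a atoms_upto_def)
qed

lemma nvsub_is_Fn: "s \<in> nvsub t \<Longrightarrow> \<exists>f ts. s = Fn f ts"
  by (induction t) auto

lemma nvsub_a_is_Fn: "s \<in> nvsub_a a \<Longrightarrow> \<exists>f ts. s = Fn f ts"
  using nvsub_is_Fn by (cases a) auto

lemma ff_nvsub_subst:
  assumes "ff_a a" "s \<in> nvsub_a a"
  shows "subst_t \<sigma> s = s"
proof -
  obtain p ts where a: "a = At p ts" by (cases a)
  then obtain t where t: "t \<in> set ts" "s \<in> nvsub t" using assms(2) by auto
  have "ff_t t" using assms(1) t(1) a by simp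
  then show ?thesis using t(2) by (cases t) simp_all
qed

fun subst_upto :: "(nat \<Rightarrow> subst) \<Rightarrow> nat \<Rightarrow> subst" where
  "subst_upto \<theta> 0 = V"
| "subst_upto \<theta> (Suc j) = scomp (subst_upto \<theta> j) (\<theta> j)"

lemma sub_upto_eq: "sub_upto \<theta> j G = substg (subst_upto \<theta> j) G"
  by (induction j) (simp_all add: substg_scomp)

context stack_queue_derivations begin

definition clause_atoms :: "atom set" where
  "clause_atoms = (\<Union>c\<in>P. insert (fst c) (fst ` snd c))"

lemma finite_clause_atoms: "finite clause_atoms"
  using program by (auto simp: clause_atoms_def program_def is_clause_def pgoal_def)

text \<open>One fixed finite set of terms serves for all \<open>j\<close>; only the substitution
  applied to it changes. Clauses contribute constants, which every substitution fixes, and by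
  \<open>mgu_nvsub\<close> unification creates only instances of compound terms already
  present.\<close>

lemma prsld_nvsub:
  assumes ff: "function_free P" and G0: "pgoal G0" and D: "inf_prsld P SQ G0 G N \<alpha> s"
  defines "\<Theta> \<equiv> subst_upto (\<lambda>i. smgu (s i))"
    and "A \<equiv> fst ` G0 \<union> clause_atoms"
  assumes a: "a \<in> subst_a (\<Theta> j) ` fst ` G0 \<union> fst ` N j"
  shows "nvsub_a a \<subseteq> subst_t (\<Theta> j) ` (\<Union>a\<in>A. nvsub_a a)" "pred_arity a \<in> pred_arity ` A"
proof -
  let ?Sub = "\<Union>a\<in>A. nvsub_a a"
  define good where "good j a \<longleftrightarrow> nvsub_a a \<subseteq> subst_t (\<Theta> j) ` ?Sub \<and> pred_arity a \<in> pred_arity ` A"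
    for j a
  have step: "s j \<in> SQ" "scl (s j) \<in> P" "sgoal (s j) = N j" "sres (s j) = G (Suc j)"
    "reduced (G j) (\<alpha> j) (N j) (vars_g (sub_upto (\<lambda>i. smgu (s i)) j G0))" for j
    using D by (auto simp: inf_prsld_def)
  have sub: "fst ` N j \<subseteq> fst ` G j" for j
    using reduced_subset(2)[OF _ step(5)] prsld_simulated(1)[OF G0 D] by blast
  have ffP: "ff_a u" if "u \<in> clause_atoms" for u
    using ff that by (auto simp: function_free_def clause_atoms_def split_beta)
  have main: "\<forall>a \<in> subst_a (\<Theta> j) ` fst ` G0 \<union> fst ` G j. good j a" for j
  proof (induction j)
    case 0
    have "G 0 = G0" using D by (simp add: inf_prsld_def)
    then show ?case by (auto simp: good_def \<Theta>_def A_def intro: rev_image_eqI)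
  next
    case (Suc j)
    obtain c \<xi> \<theta> where s: "s j = Step (N j) c \<xi> \<theta> (G (Suc j))"
      using step(3,4)[of j] by (metis step.collapse)
    have c: "c \<in> P" and sSQ: "Step (N j) c \<xi> \<theta> (G (Suc j)) \<in> SQ" using step(1,2)[of j] s by simp_all
    obtain \<pi> b p where *: "renaming \<xi>" "least_in b p (N j)"
      "idem_relevant_mgu \<theta> b (subst_a \<xi> (fst c))"
      "G (Suc j) = substg \<theta> ((N j - {(b, p)}) \<union> shift \<pi> (substg \<xi> (snd c)))"
      using SQ_valid[OF sSQ] by (auto simp: valid_step_def step_sh_def)
    have clause: "good j (subst_a \<xi> u)" if u: "u = fst c \<or> u \<in> fst ` snd c" for u
    proof -
      have uc: "u \<in> clause_atoms" using c u by (auto simp: clause_atoms_def)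
      have "(\<Union>x. nvsub (\<xi> x)) = {}" using *(1) by (auto simp: renaming_def)
      then have "nvsub_a (subst_a \<xi> u) \<subseteq> subst_t \<xi> ` nvsub_a u" using nvsub_a_subst[of \<xi> u] by simp
      also have "\<dots> = nvsub_a u" using ff_nvsub_subst[OF ffP[OF uc]] by (simp cong: image_cong_simp)
      also have "\<dots> = subst_t (\<Theta> j) ` nvsub_a u"
        using ff_nvsub_subst[OF ffP[OF uc]] by (simp cong: image_cong_simp)
      also have "\<dots> \<subseteq> subst_t (\<Theta> j) ` ?Sub" using uc by (auto simp: A_def)
      finally show ?thesis using uc by (auto simp: good_def A_def)
    qed
    have Nj: "good j a" if "a \<in> fst ` N j" for a
      by (rule bspec[OF Suc UnI2[OF subsetD[OF sub that]]])
    have G0j: "good j a" if "a \<in> subst_a (\<Theta> j) ` fst ` G0" for a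
      by (rule bspec[OF Suc UnI1[OF that]])
    have "good j b" using Nj *(2) by (force simp: least_in_def)
    then have eqs: "nvsub_a b \<union> nvsub_a (subst_a \<xi> (fst c)) \<subseteq> subst_t (\<Theta> j) ` ?Sub"
      using clause[of "fst c"] unfolding good_def by (intro Un_least) simp_all
    have mgu: "nvsub (\<theta> x) \<subseteq> subst_t \<theta> ` subst_t (\<Theta> j) ` ?Sub" for x
    proof
      fix u assume "u \<in> nvsub (\<theta> x)"
      then have "u \<in> subst_t \<theta> ` (nvsub_a b \<union> nvsub_a (subst_a \<xi> (fst c)))"
        using mgu_nvsub *(3) by (simp only: idem_relevant_mgu_def)
      then show "u \<in> subst_t \<theta> ` subst_t (\<Theta> j) ` ?Sub" using image_mono[OF eqs] by (rule rev_subsetD)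
    qed
    have subst: "good (Suc j) (subst_a \<theta> a)" if g: "good j a" for a
    proof -
      have eq: "subst_t (\<Theta> (Suc j)) ` ?Sub = subst_t \<theta> ` subst_t (\<Theta> j) ` ?Sub"
        by (simp add: \<Theta>_def s subst_t_scomp image_image)
      have "nvsub_a (subst_a \<theta> a) \<subseteq> subst_t \<theta> ` nvsub_a a \<union> (\<Union>x. nvsub (\<theta> x))"
        by (rule nvsub_a_subst)
      also have "\<dots> \<subseteq> subst_t \<theta> ` subst_t (\<Theta> j) ` ?Sub"
        using g mgu by (intro Un_least image_mono UN_least) (auto simp: good_def)
      finally show ?thesis using g unfolding good_def eq by simp
    qed
    have G: "fst ` G (Suc j) \<subseteq> subst_a \<theta> ` (fst ` N j \<union> subst_a \<xi> ` fst ` snd c)"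
      unfolding *(4) by (force simp: substg_def shift_def)
    have G0: "subst_a (\<Theta> (Suc j)) ` fst ` G0 = subst_a \<theta> ` subst_a (\<Theta> j) ` fst ` G0"
      by (simp add: \<Theta>_def s subst_a_scomp image_image)
    let ?next = "fst ` N j \<union> subst_a \<xi> ` fst ` snd c \<union> subst_a (\<Theta> j) ` fst ` G0"
    have good: "good (Suc j) a"
      if "a \<in> subst_a \<theta> ` ?next" for a
    proof -
      obtain a' where a': "a = subst_a \<theta> a'"
        "a' \<in> fst ` N j \<or> a' \<in> subst_a \<xi> ` fst ` snd c \<or> a' \<in> subst_a (\<Theta> j) ` fst ` G0"
        using \<open>a \<in> subst_a \<theta> ` _\<close> by (elim imageE) simp
      have "good j a'" if "a' \<in> subst_a \<xi> ` fst ` snd c"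
        using that by (elim imageE) (metis clause image_eqI)
      then have "good j a'" using a'(2) Nj G0j by metis
      then show ?thesis using subst a'(1) by simp
    qed
    have "fst ` G (Suc j) \<subseteq> subst_a \<theta> ` ?next"
      by (rule order_trans[OF G]) (rule image_mono, rule Un_upper1)
    moreover have "subst_a (\<Theta> (Suc j)) ` fst ` G0 \<subseteq> subst_a \<theta> ` ?next"
      unfolding G0 by (rule image_mono, rule Un_upper2)
    ultimately have "subst_a (\<Theta> (Suc j)) ` fst ` G0 \<union> fst ` G (Suc j) \<subseteq> subst_a \<theta> ` ?next"
      by (rule Un_least[rotated])
    then show ?case using good by (meson subsetD)
  qed
  have "a \<in> subst_a (\<Theta> j) ` fst ` G0 \<union> fst ` G j"
    using a by (rule rev_subsetD) (intro Un_mono order_refl sub)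
  then have "good j a" using main by (rule bspec[rotated])
  then show "nvsub_a a \<subseteq> subst_t (\<Theta> j) ` ?Sub" "pred_arity a \<in> pred_arity ` A"
    by (auto simp: good_def)
qed

lemma prsld_pruned:
  assumes ff: "function_free P" and G0: "pgoal G0" and D: "inf_prsld P SQ G0 G N \<alpha> s"
    and bounded: "\<And>l. lstep\<^sup>*\<^sup>* (glist G0) l \<Longrightarrow> length l \<le> B"
  shows "pruned_EVR G0 (\<lambda>j. smgu (s j)) N"
proof -
  let ?\<Theta> = "subst_upto (\<lambda>i. smgu (s i))"
  let ?A = "fst ` G0 \<union> clause_atoms"
  let ?Sub = "\<Union>a\<in>?A. nvsub_a a"
  let ?\<Sigma> = "{(f, length ts) | f ts. Fn f ts \<in> ?Sub}"
  let ?\<Pi> = "pred_arity ` ?A"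
  \<comment> \<open>Joining both goals in one list makes a single renaming serve both equations of
    the check. The first part always has the length of \<open>glist G0\<close>, so an equation
    between two such lists splits again.\<close>
  define st where "st j = map (subst_a (?\<Theta> j)) (glist G0) @ glist (N j)" for j
  have N: "pgoal (N j)" "simulated (glist G0) (glist (N j))" for j
    using prsld_simulated(2)[OF G0 D] by auto
  have "finite ?A" using G0 finite_clause_atoms by (simp add: pgoal_def)
  then have fin: "finite ?Sub" "finite ?\<Pi>" by (rule finite_UN_I, simp, rule finite_imageI)
  have "?\<Sigma> \<subseteq> (\<lambda>t. case t of Fn f ts \<Rightarrow> (f, length ts)) ` ?Sub" by force
  then have fin\<Sigma>: "finite ?\<Sigma>" using fin(1) by (rule finite_surj[rotated])
  have "length (glist (N j)) \<le> B" for j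
    using simulated_length[OF N(2)[of j]] bounded le_trans by blast
  then have len: "length (st j) \<le> length (glist G0) + B" for j by (simp add: st_def)
  have atoms: "set (st j) \<subseteq> atoms_upto ?\<Pi> ?\<Sigma> UNIV (card ?Sub)" for j
  proof
    fix a assume "a \<in> set (st j)"
    then have "a \<in> subst_a (?\<Theta> j) ` fst ` G0 \<union> fst ` N j"
      using set_glist[OF G0] set_glist[OF N(1)[of j]] by (auto simp: st_def)
    note a = prsld_nvsub[OF ff G0 D this]
    show "a \<in> atoms_upto ?\<Pi> ?\<Sigma> UNIV (card ?Sub)"
    proof (rule atoms_upto_of_nvsub[OF a(1) _ _ _ a(2)])
      show "finite (subst_t (?\<Theta> j) ` ?Sub)" using fin(1) by (rule finite_imageI)
      \<comment> \<open>Substitution may identify terms of the set but never adds any, hence a depth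
        bound independent of \<open>j\<close>.\<close>
      show "card (subst_t (?\<Theta> j) ` ?Sub) \<le> card ?Sub" using fin(1) by (rule card_image_le)
      show "\<forall>f ts. Fn f ts \<in> subst_t (?\<Theta> j) ` ?Sub \<longrightarrow> (f, length ts) \<in> ?\<Sigma>"
      proof (intro allI impI)
        fix f ts assume "Fn f ts \<in> subst_t (?\<Theta> j) ` ?Sub"
        then obtain u where u: "u \<in> ?Sub" "Fn f ts = subst_t (?\<Theta> j) u" by blast
        obtain us where "u = Fn f us" "length us = length ts"
          using u nvsub_a_is_Fn by fastforce
        then show "(f, length ts) \<in> ?\<Sigma>" using u(1) by (metis (mono_tags, lifting) mem_Collect_eq)
      qed
    qed
  qed
  obtain i j \<tau> where ij: "i < j" "renaming \<tau>" "st j = map (subst_a \<tau>) (st i)"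
    using finitely_many_variants[OF fin(2) fin\<Sigma> len atoms] by blast
  then have G0\<tau>: "map (subst_a (?\<Theta> j)) (glist G0) = map (subst_a \<tau>) (map (subst_a (?\<Theta> i)) (glist G0))"
    and N\<tau>: "glist (N j) = map (subst_a \<tau>) (glist (N i))"
    by (simp_all add: st_def)
  have eq: "subst_a (?\<Theta> j) a = subst_a \<tau> (subst_a (?\<Theta> i) a)" if "a \<in> fst ` G0" for a
    using that G0\<tau> set_glist[OF G0] by auto
  have "sub_upto (\<lambda>j. smgu (s j)) j G0 = substg \<tau> (sub_upto (\<lambda>j. smgu (s j)) i G0)"
    unfolding sub_upto_eq substg_def image_image
  proof (rule image_cong[OF refl], clarify, intro conjI refl)
    fix a p assume "(a, p) \<in> G0"
    then have "a \<in> fst ` G0" by force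
    then show "subst_a (?\<Theta> j) a = subst_a \<tau> (subst_a (?\<Theta> i) a)" by (rule eq)
  qed
  moreover obtain \<pi> where "shifting \<pi>" "N j = shift \<pi> (substg \<tau> (N i))"
    using glist_eq_imp_shift[of "substg \<tau> (N i)" "N j"] N(1) N\<tau> by (auto simp: pgoal_substg glist_substg)
  ultimately show ?thesis using ij(1,2) unfolding pruned_EVR_def by blast
qed

end

text \<open>Stack part, remaining goal and queue part occupy increasing ranges of priorities, so the
  list of the resolvent is the concatenation of their lists and the shifting disappears.\<close>

lemma stack_queue_split:
  assumes P: "program P" and SQ: "stack_queue SQ"
  shows "\<exists>ms mq. stack_queue_derivations P ms mq SQ"
proof -
  have "\<exists>Ms Mq. snd c = Ms \<union> Mq \<and>
     (\<forall>G \<xi> \<theta> R. Step G c \<xi> \<theta> R \<in> SQ \<longrightarrow>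
        (\<exists>a p \<gamma>. least_in a p G \<and> shifting \<gamma> \<and>
           prio_lt (shift \<gamma> (substg \<xi> Ms)) (G - {(a, p)}) \<and>
           prio_lt (G - {(a, p)}) (shift \<gamma> (substg \<xi> Mq)) \<and>
           prio_lt (shift \<gamma> (substg \<xi> Ms)) (shift \<gamma> (substg \<xi> Mq)) \<and>
           R = substg \<theta> (shift \<gamma> (substg \<xi> Ms) \<union> (G - {(a, p)}) \<union> shift \<gamma> (substg \<xi> Mq))))"
    if "c \<in> P" for c
  proof -
    have "pgoal (snd c)" using P that by (auto simp: program_def is_clause_def)
    then show ?thesis using SQ unfolding stack_queue_def by (metis prod.collapse)
  qed
  then obtain Ms Mq where split: "\<And>c. c \<in> P \<Longrightarrow> snd c = Ms c \<union> Mq c"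
    and res: "\<And>c G \<xi> \<theta> R. c \<in> P \<Longrightarrow> Step G c \<xi> \<theta> R \<in> SQ \<Longrightarrow>
        \<exists>a p \<gamma>. least_in a p G \<and> shifting \<gamma> \<and>
           prio_lt (shift \<gamma> (substg \<xi> (Ms c))) (G - {(a, p)}) \<and>
           prio_lt (G - {(a, p)}) (shift \<gamma> (substg \<xi> (Mq c))) \<and>
           prio_lt (shift \<gamma> (substg \<xi> (Ms c))) (shift \<gamma> (substg \<xi> (Mq c))) \<and>
           R = substg \<theta> (shift \<gamma> (substg \<xi> (Ms c)) \<union> (G - {(a, p)}) \<union> shift \<gamma> (substg \<xi> (Mq c)))"
    by metis
  have body: "pgoal (Ms c)" "pgoal (Mq c)" if "c \<in> P" for c
  proof -
    have "pgoal (snd c)" using P that by (auto simp: program_def is_clause_def)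
    then show "pgoal (Ms c)" "pgoal (Mq c)" using pgoal_subset split[OF that] by auto
  qed
  have complete: "complete_steps SQ" using SQ by (simp add: stack_queue_def)
  have "stack_queue_derivations P (\<lambda>c. glist (Ms c)) (\<lambda>c. glist (Mq c)) SQ"
  proof
    show "program P" "complete_steps SQ" by fact+
    show "set (glist (Ms c)) \<union> set (glist (Mq c)) \<subseteq> fst ` snd c" if "c \<in> P" for c
      using split body that by (simp add: set_glist image_Un)
    fix G c \<xi> \<theta> R assume s: "Step G c \<xi> \<theta> R \<in> SQ" and c: "c \<in> P"
    obtain a p \<gamma> where *: "least_in a p G" "shifting \<gamma>"
      and lt: "prio_lt (shift \<gamma> (substg \<xi> (Ms c))) (G - {(a, p)})"
        "prio_lt (G - {(a, p)}) (shift \<gamma> (substg \<xi> (Mq c)))"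
        "prio_lt (shift \<gamma> (substg \<xi> (Ms c))) (shift \<gamma> (substg \<xi> (Mq c)))"
      and R: "R = substg \<theta> (shift \<gamma> (substg \<xi> (Ms c)) \<union> (G - {(a, p)}) \<union> shift \<gamma> (substg \<xi> (Mq c)))"
      using res[OF c s] by blast
    have G: "pgoal G" using s complete by (force simp: complete_steps_def valid_step_def step_sh_def)
    let ?S = "shift \<gamma> (substg \<xi> (Ms c))" and ?K = "G - {(a, p)}" and ?Q = "shift \<gamma> (substg \<xi> (Mq c))"
    have pg: "pgoal ?S" "pgoal ?K" "pgoal ?Q"
      using body[OF c] *(2) G by (auto intro: pgoal_shift pgoal_substg pgoal_subset)
    have gl: "glist ?S = map (subst_a \<xi>) (glist (Ms c))" "glist ?Q = map (subst_a \<xi>) (glist (Mq c))"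
      using body[OF c] *(2) by (simp_all add: glist_shift glist_substg pgoal_substg)
    have "prio_disj ?S ?K" using lt(1) by (force simp: prio_lt_def prio_disj_def)
    then have SK: "pgoal (?S \<union> ?K)" using pg by (simp add: pgoal_Un)
    have ltQ: "prio_lt (?S \<union> ?K) ?Q" using lt(2,3) by (force simp: prio_lt_def prios_def)
    then have "prio_disj (?S \<union> ?K) ?Q" by (force simp: prio_lt_def prio_disj_def)
    then have "pgoal (?S \<union> ?K \<union> ?Q)" using SK pg by (simp add: pgoal_Un)
    moreover have "glist (?S \<union> ?K \<union> ?Q) = glist ?S @ glist ?K @ glist ?Q"
      using SK pg lt(1) ltQ by (simp add: glist_Un)
    ultimately show "glist R = map (subst_a \<theta>) (map (subst_a \<xi>) (glist (Ms c)) @ tl (glist G) @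
        map (subst_a \<xi>) (glist (Mq c)))"
      unfolding R using glist_least[OF G *(1)] gl by (simp add: glist_substg)
  qed
  then show ?thesis by blast
qed

theorem theoremt5p2p1:
  assumes "program P" and "function_free P" and "pgoal G0" and "stack_queue SQ"
    and "\<forall>s. inf_psld P SQ G0 s \<longrightarrow> pruned_EVR G0 (\<lambda>j. smgu (s j)) (\<lambda>j. sgoal (s j))"
  shows "\<forall>G N \<alpha> s. inf_prsld P SQ G0 G N \<alpha> s \<longrightarrow> pruned_EVR G0 (\<lambda>j. smgu (s j)) N"
proof -
  obtain ms mq where "stack_queue_derivations P ms mq SQ"
    using stack_queue_split assms(1,4) by blast
  then interpret stack_queue_derivations P ms mq SQ .
  obtain B where "\<And>l. lstep\<^sup>*\<^sup>* (glist G0) l \<Longrightarrow> length l \<le> B"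
    using reachable_bounded assms(3,5) by blast
  then show ?thesis using prsld_pruned assms(2,3) by blast
qed

end
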